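(* Let $0<\alpha\le\pi/2$ and let $\mathcal S_\alpha=\{re^{i\theta}: r\ge 0,\ |\theta|\le\alpha\}\subset\mathbb C$. For every complex Hilbert space $\mathcal H$, every bounded operator on $\mathcal H$ of the form $B=\lambda I+N$ with $\lambda\in\mathbb C$, $N^2=0$ and $W(B)\subset\mathcal S_\alpha$, and every function $f$ holomorphic in the interior of $\mathcal S_\alpha$, continuous on the one-point compactification of $\mathcal S_\alpha$, and satisfying $\|f\|_\infty\le 1$, one has $$\|f(B)\|\le \frac{\pi\sin\alpha}{2\alpha}.$$ The constant is best possible: equality is attained on $\mathbb C^2$ by $$B_\alpha=I+2\sin\alpha\begin{pmatrix}0&1\\0&0\end{pmatrix},\qquad f_\alpha(z)=\frac{z^{\pi/(2\alpha)}-1}{z^{\pi/(2\alpha)}+1},$$ where the power is taken with $|\arg z|<\alpha$.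
   Context: $W(B)=\{\langle Bx,x\rangle:\|x\|=1\}$ is the numerical range and $\|\cdot\|$ the operator norm; $\|f\|_\infty$ is the supremum of $|f|$ on $\mathcal S_\alpha$. The operator $f(B)$ is given by the holomorphic functional calculus when $\lambda$ lies in the interior of $\mathcal S_\alpha$; when $N=0$, $f(B)=f(\lambda)I$. (If $W(B)\subset\mathcal S_\alpha$ and $\lambda$ is not in the interior of $\mathcal S_\alpha$, then $\lambda\in\partial\mathcal S_\alpha$ and $N=0$, so all cases are covered.) *)

theory Defs
  imports "HOL-Complex_Analysis.Complex_Analysis"
begin

section \<open>Complex Hilbert spaces\<close>

text \<open>
  The complex structure extends the real one of \<^class>\<open>banach\<close>. The inner product is linear in the
  first argument; its positivity follows from \<open>cinner_self\<close>. The zero space is included.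
\<close>

class complex_hilbert_space = banach +
  fixes scaleC :: "complex \<Rightarrow> 'a \<Rightarrow> 'a" (infixr \<open>*\<^sub>C\<close> 75)
    and cinner :: "'a \<Rightarrow> 'a \<Rightarrow> complex"
  assumes scaleC_add_right: "c *\<^sub>C (x + y) = c *\<^sub>C x + c *\<^sub>C y"
    and scaleC_add_left: "(c + d) *\<^sub>C x = c *\<^sub>C x + d *\<^sub>C x"
    and scaleC_scaleC: "c *\<^sub>C d *\<^sub>C x = (c * d) *\<^sub>C x"
    and scaleR_scaleC: "r *\<^sub>R x = complex_of_real r *\<^sub>C x"
    and cinner_commute: "cinner x y = cnj (cinner y x)"
    and cinner_add_left: "cinner (x + y) z = cinner x z + cinner y z"
    and cinner_scaleC_left: "cinner (c *\<^sub>C x) y = c * cinner x y"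
    and cinner_self: "cinner x x = complex_of_real ((norm x)\<^sup>2)"

instantiation complex :: complex_hilbert_space
begin

definition scaleC_complex :: "complex \<Rightarrow> complex \<Rightarrow> complex" where
  "scaleC_complex c z = c * z"

definition cinner_complex :: "complex \<Rightarrow> complex \<Rightarrow> complex" where
  "cinner_complex x y = x * cnj y"

instance
  by standard
    (auto simp: scaleC_complex_def cinner_complex_def algebra_simps scaleR_conv_of_real
      complex_norm_square[symmetric])

end

instantiation vec :: (complex_hilbert_space, finite) complex_hilbert_space
begin

definition scaleC_vec :: "complex \<Rightarrow> 'a ^ 'b \<Rightarrow> 'a ^ 'b" where
  "scaleC_vec c x = (\<chi> i. c *\<^sub>C x $ i)"

definition cinner_vec :: "'a ^ 'b \<Rightarrow> 'a ^ 'b \<Rightarrow> complex" where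
  "cinner_vec x y = (\<Sum>i\<in>UNIV. cinner (x $ i) (y $ i))"

instance
proof
  fix x y z :: "'a ^ 'b" and c d :: complex and r :: real
  show "c *\<^sub>C (x + y) = c *\<^sub>C x + c *\<^sub>C y"
    by (simp add: scaleC_vec_def vec_eq_iff scaleC_add_right)
  show "(c + d) *\<^sub>C x = c *\<^sub>C x + d *\<^sub>C x"
    by (simp add: scaleC_vec_def vec_eq_iff scaleC_add_left)
  show "c *\<^sub>C d *\<^sub>C x = (c * d) *\<^sub>C x"
    by (simp add: scaleC_vec_def vec_eq_iff scaleC_scaleC)
  show "r *\<^sub>R x = complex_of_real r *\<^sub>C x"
    by (simp add: scaleC_vec_def vec_eq_iff scaleR_scaleC)
  show "cinner x y = cnj (cinner y x)"
    unfolding cinner_vec_def cnj_sum by (intro sum.cong refl cinner_commute)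
  show "cinner (x + y) z = cinner x z + cinner y z"
    by (simp add: cinner_vec_def cinner_add_left sum.distrib)
  show "cinner (c *\<^sub>C x) y = c * cinner x y"
    by (simp add: cinner_vec_def scaleC_vec_def cinner_scaleC_left sum_distrib_left)
  show "cinner x x = complex_of_real ((norm x)\<^sup>2)"
    by (simp add: cinner_vec_def cinner_self norm_vec_def L2_set_def sum_nonneg)
qed

end

lemma norm_scaleC: "norm (c *\<^sub>C x) = cmod c * norm (x :: 'a::complex_hilbert_space)"
proof -
  have "cinner (c *\<^sub>C x) (c *\<^sub>C x) = c * cnj c * cinner x x"
    by (metis cinner_commute cinner_scaleC_left complex_cnj_mult mult.assoc)
  also have "\<dots> = complex_of_real ((cmod c * norm x)\<^sup>2)"
    by (simp add: cinner_self complex_norm_square[symmetric] power_mult_distrib del: of_real_power)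
  finally have "complex_of_real ((norm (c *\<^sub>C x))\<^sup>2) = complex_of_real ((cmod c * norm x)\<^sup>2)"
    by (simp only: cinner_self)
  then have "(norm (c *\<^sub>C x))\<^sup>2 = (cmod c * norm x)\<^sup>2"
    by (simp only: of_real_eq_iff)
  then show ?thesis
    by (rule power2_eq_imp_eq) simp_all
qed

section \<open>Bounded operators\<close>

text \<open>
  Bounded operators are the complex-linear elements of \<open>'a \<Rightarrow>\<^sub>L 'a\<close>, which consists of the bounded
  real-linear maps; \<^const>\<open>norm\<close> on this type is the operator norm.
\<close>

definition clinear_op :: "('a::complex_hilbert_space \<Rightarrow>\<^sub>L 'a) \<Rightarrow> bool" where
  "clinear_op T \<longleftrightarrow> (\<forall>c x. blinfun_apply T (c *\<^sub>C x) = c *\<^sub>C blinfun_apply T x)"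

lift_definition scalar_op :: "complex \<Rightarrow> 'a::complex_hilbert_space \<Rightarrow>\<^sub>L 'a"
  is "\<lambda>c x. c *\<^sub>C x"
proof
  fix c :: complex and x y :: 'a and r :: real
  show "c *\<^sub>C (x + y) = c *\<^sub>C x + c *\<^sub>C y"
    by (rule scaleC_add_right)
  show "c *\<^sub>C r *\<^sub>R x = r *\<^sub>R c *\<^sub>C x"
    by (simp add: scaleR_scaleC scaleC_scaleC mult.commute)
  show "\<exists>K. \<forall>x::'a. norm (c *\<^sub>C x) \<le> norm x * K"
    by (metis norm_scaleC mult.commute order_refl)
qed

lift_definition matrix_op :: "complex ^ 'n ^ 'n \<Rightarrow> (complex ^ 'n) \<Rightarrow>\<^sub>L (complex ^ 'n)"
  is "\<lambda>A x. A *v x"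
  by (rule matrix_vector_mul_bounded_linear)

definition numerical_range :: "('a::complex_hilbert_space \<Rightarrow>\<^sub>L 'a) \<Rightarrow> complex set" where
  "numerical_range B = {cinner (blinfun_apply B x) x | x. norm x = 1}"

definition is_inverse_op :: "('a::complex_hilbert_space \<Rightarrow>\<^sub>L 'a) \<Rightarrow> ('a \<Rightarrow>\<^sub>L 'a) \<Rightarrow> bool" where
  "is_inverse_op T R \<longleftrightarrow> R o\<^sub>L T = id_blinfun \<and> T o\<^sub>L R = id_blinfun"

definition spectrum :: "('a::complex_hilbert_space \<Rightarrow>\<^sub>L 'a) \<Rightarrow> complex set" where
  "spectrum B = {z. \<nexists>R. is_inverse_op (scalar_op z - B) R}"

definition resolvent :: "('a::complex_hilbert_space \<Rightarrow>\<^sub>L 'a) \<Rightarrow> complex \<Rightarrow> 'a \<Rightarrow>\<^sub>L 'a" where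
  "resolvent B z = (THE R. is_inverse_op (scalar_op z - B) R)"

section \<open>Holomorphic functional calculus\<close>

text \<open>The operator-valued analogue of \<^const>\<open>contour_integral\<close>, converging in operator norm.\<close>

definition op_contour_integral ::
    "(real \<Rightarrow> complex) \<Rightarrow> (complex \<Rightarrow> 'a::complex_hilbert_space \<Rightarrow>\<^sub>L 'a) \<Rightarrow> 'a \<Rightarrow>\<^sub>L 'a" where
  "op_contour_integral \<gamma> F =
     integral {0..1} (\<lambda>t. scalar_op (vector_derivative \<gamma> (at t within {0..1})) o\<^sub>L F (\<gamma> t))"

text \<open>
  A single closed path (rather than a cycle) is enough for a convex domain \<open>U\<close> such as the interior
  of a sector.
\<close>

definition calculus_contour ::
    "complex set \<Rightarrow> ('a::complex_hilbert_space \<Rightarrow>\<^sub>L 'a) \<Rightarrow> (real \<Rightarrow> complex) \<Rightarrow> bool" where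
  "calculus_contour U B \<gamma> \<longleftrightarrow>
     valid_path \<gamma> \<and> pathfinish \<gamma> = pathstart \<gamma> \<and> path_image \<gamma> \<subseteq> U - spectrum B \<and>
     (\<forall>z\<in>spectrum B. winding_number \<gamma> z = 1) \<and> (\<forall>z. z \<notin> U \<longrightarrow> winding_number \<gamma> z = 0)"

text \<open>
  \<open>f(B)\<close> is the Riesz--Dunford integral of \<open>f(z) (z I - B)\<^sup>-\<^sup>1\<close> over \<open>\<gamma>\<close>, divided by \<open>2 \<pi> \<i>\<close>. For \<open>f\<close>
  holomorphic on the open set \<open>U\<close> it does not depend on the contour, so any one may be chosen.
\<close>

definition hol_calculus ::
    "complex set \<Rightarrow> (complex \<Rightarrow> complex) \<Rightarrow> ('a::complex_hilbert_space \<Rightarrow>\<^sub>L 'a) \<Rightarrow> 'a \<Rightarrow>\<^sub>L 'a" where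
  "hol_calculus U f B =
     scalar_op (1 / (2 * of_real pi * \<i>)) o\<^sub>L
     op_contour_integral (SOME \<gamma>. calculus_contour U B \<gamma>) (\<lambda>z. scalar_op (f z) o\<^sub>L resolvent B z)"

section \<open>Sectors and the admissible operators and functions\<close>

definition sector :: "real \<Rightarrow> complex set" where
  "sector \<alpha> = {rcis r \<theta> | r \<theta>. 0 \<le> r \<and> \<bar>\<theta>\<bar> \<le> \<alpha>}"

definition sector_op ::
    "real \<Rightarrow> ('a::complex_hilbert_space \<Rightarrow>\<^sub>L 'a) \<Rightarrow> complex \<Rightarrow> ('a \<Rightarrow>\<^sub>L 'a) \<Rightarrow> bool" where
  "sector_op \<alpha> B \<mu> N \<longleftrightarrow>
     clinear_op B \<and> B = scalar_op \<mu> + N \<and> N o\<^sub>L N = 0 \<and> numerical_range B \<subseteq> sector \<alpha>"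

text \<open>
  \<open>L\<close> is the value of \<open>f\<close> at the point at infinity \<^const>\<open>None\<close>. Continuity on the compactification
  makes \<open>f\<close> bounded on the sector, so the supremum is a genuine one.
\<close>

definition sector_fun :: "real \<Rightarrow> (complex \<Rightarrow> complex) \<Rightarrow> bool" where
  "sector_fun \<alpha> f \<longleftrightarrow>
     f holomorphic_on interior (sector \<alpha>) \<and>
     (\<exists>L. continuous_map (Alexandroff_compactification (top_of_set (sector \<alpha>))) euclidean
            (case_option L f)) \<and>
     (SUP z\<in>sector \<alpha>. cmod (f z)) \<le> 1"

section \<open>The extremal pair\<close>

definition B_ext :: "real \<Rightarrow> (complex ^ 2) \<Rightarrow>\<^sub>L (complex ^ 2)" where
  "B_ext \<alpha> = matrix_op (mat 1 + (2 * sin \<alpha>) *\<^sub>R vector [vector [0, 1], vector [0, 0]])"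

text \<open>
  On the sector, where \<open>\<bar>arg z\<bar> \<le> \<alpha> \<le> \<pi>/2\<close>, the principal power \<^const>\<open>powr\<close> is the intended
  branch, extended continuously to the boundary (with value \<open>0\<close> at \<open>0\<close>).
\<close>

definition f_ext :: "real \<Rightarrow> complex \<Rightarrow> complex" where
  "f_ext \<alpha> z =
     (z powr of_real (pi / (2 * \<alpha>)) - 1) / (z powr of_real (pi / (2 * \<alpha>)) + 1)"

end

theory Submission
  imports Defs
begin

text \<open>
  Write \<open>B = \<mu> I + N\<close> with \<open>N\<^sup>2 = 0\<close> and put \<open>p = \<pi> / (2 \<alpha>)\<close>, \<open>m = p sin \<alpha>\<close>; concavity of the sine gives
  \<open>m \<ge> 1\<close>. The resolvent of \<open>B\<close> is \<open>(z - \<mu>)\<^sup>-\<^sup>1 I + (z - \<mu>)\<^sup>-\<^sup>2 N\<close>, so Cauchy's formula yields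
  \<open>f(B) = f(\<mu>) I + f'(\<mu>) N\<close> (\<open>hol_calculus_square_zero\<close>). Three estimates then meet.

  The geometry of the numerical range: on the span of \<open>N x\<close> and the component of \<open>x\<close> orthogonal to it,
  \<open>N\<close> is a nilpotent Jordan block. Hence \<open>W(B)\<close> is, up to its boundary, a disc about \<open>\<mu>\<close> of radius
  \<open>\<parallel>N\<parallel> / 2\<close>, and this disc fits into the sector only if \<open>\<parallel>N\<parallel>\<close> is at most twice the distance of \<open>\<mu>\<close> to
  the edges (\<open>square_zero_half_plane\<close>). In particular \<open>\<mu>\<close> is an interior point unless \<open>N = 0\<close>.

  The growth of \<open>f'\<close>: the power \<open>z\<^sup>p\<close> maps the sector to the right half-plane, so the Schwarz--Pick
  inequality bounds \<open>\<bar>f'(\<mu>)\<bar>\<close> at \<open>\<mu> = r e\<^sup>i\<^sup>\<theta>\<close> by \<open>(1 - \<bar>f(\<mu>)\<bar>\<^sup>2) p / (2 r cos (p \<theta>))\<close>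
  (\<open>Schwarz_Pick_sector\<close>). The distance to the edges is at most \<open>r sin (\<alpha> - \<bar>\<theta>\<bar>)\<close>, and since
  \<open>sin t / sin (p t)\<close> increases on \<open>(0, \<alpha>]\<close> the product is largest on the axis, where it equals \<open>m\<close>.
  This gives \<open>\<bar>f'(\<mu>)\<bar> \<parallel>N\<parallel> \<le> m (1 - \<bar>f(\<mu>)\<bar>\<^sup>2)\<close> (\<open>deriv_bound_sector\<close>).

  The norm: a \<open>2 \<times> 2\<close> Jordan block with diagonal entry \<open>a\<close>, \<open>\<bar>a\<bar> \<le> 1\<close>, and corner at most \<open>m (1 - \<bar>a\<bar>\<^sup>2)\<close>
  has norm at most \<open>m\<close> as soon as \<open>m \<ge> 1\<close> (\<open>norm_scalar_plus_square_zero_le\<close>).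

  All three are equalities for \<open>\<mu> = 1\<close>, \<open>\<parallel>N\<parallel> = 2 sin \<alpha>\<close> and the Cayley transform of \<open>z\<^sup>p\<close>, for which
  \<open>f(1) = 0\<close> and \<open>f'(1) = p / 2\<close>; this is the extremal pair.
\<close>

section \<open>Square-zero operators on a complex Hilbert space\<close>

lemma scaleC_one [simp]: "1 *\<^sub>C x = (x :: 'a::complex_hilbert_space)"
  using scaleR_scaleC[of 1 x] by simp

lemma scaleC_zero [simp]: "0 *\<^sub>C x = (0 :: 'a::complex_hilbert_space)"
  using scaleR_scaleC[of 0 x] by simp

lemma scaleC_zero_right [simp]: "c *\<^sub>C (0 :: 'a::complex_hilbert_space) = 0"
  by (metis mult_zero_right scaleC_zero scaleC_scaleC)

lemma cinner_add_right: "cinner x (y + z) = cinner x y + cinner x (z :: 'a::complex_hilbert_space)"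
  by (metis cinner_commute cinner_add_left complex_cnj_add)

lemma cinner_scaleC_right: "cinner x (c *\<^sub>C y) = cnj c * cinner x (y :: 'a::complex_hilbert_space)"
  by (metis cinner_commute cinner_scaleC_left complex_cnj_mult)

lemma norm_add_orthogonal:
  assumes "cinner x y = 0"
  shows "(norm (x + y :: 'a::complex_hilbert_space))\<^sup>2 = (norm x)\<^sup>2 + (norm y)\<^sup>2"
proof -
  have "cinner y x = 0"
    using assms cinner_commute[of y x] by simp
  then have "cinner (x + y) (x + y) = cinner x x + cinner y y"
    using assms by (simp add: cinner_add_left cinner_add_right)
  then have "complex_of_real ((norm (x + y))\<^sup>2) = complex_of_real ((norm x)\<^sup>2 + (norm y)\<^sup>2)"
    by (simp add: cinner_self)
  then show ?thesis
    by (simp only: of_real_eq_iff)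
qed

lemma orthogonal_decomposition:
  fixes x y :: "'a::complex_hilbert_space"
  obtains s w where "x = s *\<^sub>C y + w" "cinner y w = 0"
proof (cases "y = 0")
  case True
  have "cinner y x = 0 * cinner y x"
    using cinner_scaleC_left[of 0 y x] True by simp
  with True show ?thesis
    by (intro that[of 0 x]) auto
next
  case False
  define s where "s = cinner x y / cinner y y"
  have [simp]: "cinner y y \<noteq> 0"
    using False by (simp add: cinner_self)
  have "cinner y x = cinner y (s *\<^sub>C y) + cinner y (x - s *\<^sub>C y)"
    by (simp flip: cinner_add_right)
  moreover have "cinner y (s *\<^sub>C y) = cinner y x"
  proof -
    have "cnj s * cnj (cinner y y) = cnj (cinner x y)"
      by (simp add: s_def)
    then show ?thesis
      by (metis cinner_commute cinner_scaleC_right)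
  qed
  ultimately show ?thesis
    by (intro that[of s "x - s *\<^sub>C y"]) auto
qed

lemma scalar_op_apply [simp]: "blinfun_apply (scalar_op c) x = c *\<^sub>C x"
  by transfer simp

lemma norm_scalar_op_le: "norm (scalar_op c) \<le> cmod c"
  by (rule norm_blinfun_bound) (auto simp: norm_scaleC)

text \<open>
  Since \<open>T y = 0\<close> for \<open>y = T x\<close>, subtracting from \<open>x\<close> its component along \<open>y\<close> does not change
  \<open>T x\<close>. Hence \<open>y\<close> and the remainder \<open>w\<close> span an orthogonal model on which \<open>T\<close> acts as a \<open>2 \<times> 2\<close>
  Jordan block; this replaces the splitting of the whole space along the kernel of \<open>T\<close>.
\<close>

lemma square_zero_decomposition:
  fixes T :: "'a::complex_hilbert_space \<Rightarrow>\<^sub>L 'a"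
  assumes "clinear_op T" "T o\<^sub>L T = 0"
  obtains s w where "x = s *\<^sub>C T x + w" "cinner (T x) w = 0" "T w = T x" "T (T x) = 0"
proof -
  have TT: "T (T z) = 0" for z
    using arg_cong[OF assms(2), of "\<lambda>S. blinfun_apply S z"] by simp
  obtain s w where *: "x = s *\<^sub>C T x + w" "cinner (T x) w = 0"
    by (rule orthogonal_decomposition)
  then have "T (s *\<^sub>C T x) = 0"
    using assms(1) by (simp add: clinear_op_def TT)
  then have "T x = T w"
    using arg_cong[OF *(1), of "blinfun_apply T"] by (simp add: blinfun.add_right)
  then show ?thesis
    using * TT by (intro that) auto
qed

text \<open>
  The quadratic form \<open>m\<^sup>2 (u\<^sup>2 + v\<^sup>2) - (x u + c v)\<^sup>2 - (x v)\<^sup>2\<close> expresses that the Jordan block with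
  diagonal \<open>x\<close> and corner \<open>c\<close> has norm at most \<open>m\<close>. At the largest admissible corner, and with
  \<open>q = 1 - x\<^sup>2\<close>, its determinant is \<open>x\<^sup>2 (m\<^sup>2 - 1) ((m\<^sup>2 - 1) + (m\<^sup>2 + 1) q)\<close>, which is nonnegative
  for \<open>m \<ge> 1\<close>.
\<close>

lemma jordan_block_bound:
  fixes m x c u v :: real
  assumes m: "1 \<le> m" and x: "0 \<le> x" "x \<le> 1" and c: "0 \<le> c" "c \<le> m * (1 - x\<^sup>2)"
    and uv: "0 \<le> u" "0 \<le> v"
  shows "(x * u + c * v)\<^sup>2 + (x * v)\<^sup>2 \<le> m\<^sup>2 * (u\<^sup>2 + v\<^sup>2)"
proof -
  define q where "q = 1 - x\<^sup>2"
  have q: "0 \<le> q" "q \<le> 1"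
    using x by (auto simp: q_def power_le_one)
  define M where "M = m\<^sup>2"
  have M: "1 \<le> M"
    using m by (simp add: M_def)
  define A where "A = M - 1 + q"
  define C where "C = x\<^sup>2 * (M * (1 + q) - 1)"
  define b where "b = x * m * q"
  have "x * u + c * v \<le> x * u + m * q * v"
    using c uv by (simp add: q_def mult_right_mono)
  then have "(x * u + c * v)\<^sup>2 \<le> (x * u + m * q * v)\<^sup>2"
    using x c uv by (intro power_mono) auto
  moreover have "(x * u + m * q * v)\<^sup>2 + (x * v)\<^sup>2 \<le> m\<^sup>2 * (u\<^sup>2 + v\<^sup>2)"
  proof -
    have eq: "m\<^sup>2 * (u\<^sup>2 + v\<^sup>2) - (x * u + m * q * v)\<^sup>2 - (x * v)\<^sup>2
        = A * u\<^sup>2 - 2 * b * u * v + C * v\<^sup>2"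
      unfolding A_def C_def b_def q_def M_def by algebra
    have det: "A * C - b\<^sup>2 = x\<^sup>2 * ((M - 1)\<^sup>2 + (M - 1) * (1 + M) * q)"
      unfolding A_def C_def b_def M_def by algebra
    have "0 \<le> x\<^sup>2 * ((M - 1)\<^sup>2 + (M - 1) * (1 + M) * q)"
      using M q by (intro mult_nonneg_nonneg add_nonneg_nonneg) auto
    with det have D: "0 \<le> A * C - b\<^sup>2"
      by simp
    have "0 \<le> A * u\<^sup>2 - 2 * b * u * v + C * v\<^sup>2"
    proof (cases "A = 0")
      case True
      then have "M = 1" "q = 0"
        using M q by (auto simp: A_def)
      then show ?thesis
        by (simp add: A_def b_def C_def)
    next
      case False
      then have A: "0 < A"
        using M q by (auto simp: A_def)
      have "A * (A * u\<^sup>2 - 2 * b * u * v + C * v\<^sup>2) = (A * u - b * v)\<^sup>2 + (A * C - b\<^sup>2) * v\<^sup>2"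
        by algebra
      also have "\<dots> \<ge> 0"
        using D by (intro add_nonneg_nonneg mult_nonneg_nonneg) auto
      finally show ?thesis
        using A by (simp add: zero_le_mult_iff)
    qed
    with eq show ?thesis
      by simp
  qed
  ultimately show ?thesis
    by linarith
qed

text \<open>
  In the orthogonal splitting of \<open>x\<close> along \<open>T x\<close> and \<open>w\<close>, the triangle inequality replaces the operator
  by the real Jordan block with diagonal \<open>\<bar>a\<bar>\<close> and corner \<open>\<bar>b\<bar> \<parallel>T\<parallel>\<close>.
\<close>

lemma norm_scalar_plus_square_zero_le:
  fixes T :: "'a::complex_hilbert_space \<Rightarrow>\<^sub>L 'a"
  assumes T: "clinear_op T" "T o\<^sub>L T = 0" and b: "cmod b * norm T \<le> m * (1 - (cmod a)\<^sup>2)"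
    and a: "cmod a \<le> 1" and m: "1 \<le> m"
  shows "norm (scalar_op a + (scalar_op b o\<^sub>L T)) \<le> m"
proof (rule norm_blinfun_bound)
  show "0 \<le> m"
    using m by simp
  fix x :: 'a
  obtain s w where *: "x = s *\<^sub>C T x + w" "cinner (T x) w = 0" "T w = T x"
    using square_zero_decomposition[OF T] by metis
  define u where "u = cmod s * norm (T x)"
  have nx: "(norm x)\<^sup>2 = u\<^sup>2 + (norm w)\<^sup>2"
    using norm_add_orthogonal[of "s *\<^sub>C T x" w] *(1,2)
    by (simp add: cinner_scaleC_left norm_scaleC u_def)
  have "a *\<^sub>C x + b *\<^sub>C T x = (a * s + b) *\<^sub>C T x + a *\<^sub>C w"
    by (subst *(1)) (simp add: scaleC_add_left scaleC_add_right scaleC_scaleC)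
  then have "(norm (a *\<^sub>C x + b *\<^sub>C T x))\<^sup>2
      = (cmod (a * s + b) * norm (T x))\<^sup>2 + (cmod a * norm w)\<^sup>2"
    using norm_add_orthogonal[of "(a * s + b) *\<^sub>C T x" "a *\<^sub>C w"] *(2)
    by (simp add: cinner_scaleC_left cinner_scaleC_right norm_scaleC)
  also have "cmod (a * s + b) * norm (T x) \<le> cmod a * u + cmod b * norm T * norm w"
  proof -
    have "cmod (a * s + b) * norm (T x) \<le> (cmod a * cmod s + cmod b) * norm (T x)"
      by (intro mult_right_mono order_trans[OF norm_triangle_ineq]) (auto simp: norm_mult)
    also have "\<dots> = cmod a * u + cmod b * norm (T w)"
      by (simp add: u_def algebra_simps *(3))
    also have "norm (T w) \<le> norm T * norm w"
      by (rule norm_blinfun)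
    finally show ?thesis
      by (simp add: mult_left_mono mult.assoc)
  qed
  then have "(cmod (a * s + b) * norm (T x))\<^sup>2 + (cmod a * norm w)\<^sup>2
      \<le> (cmod a * u + cmod b * norm T * norm w)\<^sup>2 + (cmod a * norm w)\<^sup>2"
    by (intro add_right_mono power_mono) auto
  also have "\<dots> \<le> m\<^sup>2 * (u\<^sup>2 + (norm w)\<^sup>2)"
    using a m b by (intro jordan_block_bound) (auto simp: u_def)
  finally have "(norm (a *\<^sub>C x + b *\<^sub>C T x))\<^sup>2 \<le> (m * norm x)\<^sup>2"
    by (simp add: nx power_mult_distrib)
  then have "norm (a *\<^sub>C x + b *\<^sub>C T x) \<le> m * norm x"
    by (rule power2_le_imp_le) (use m in simp)
  then show "norm ((scalar_op a + (scalar_op b o\<^sub>L T)) x) \<le> m * norm x"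
    by (simp add: blinfun.add_left)
qed

text \<open>
  Let \<open>w\<close> be the component of \<open>x\<close> orthogonal to \<open>N x\<close>. The equal-weight combination of the unit
  vectors along \<open>N x\<close> and \<open>w\<close> produces a point of the numerical range at distance
  \<open>\<parallel>N x\<parallel> / (2 \<parallel>w\<parallel>)\<close> from \<open>\<mu>\<close>; the phase can be chosen so that this point lies straight in the
  direction of the edge of the half-plane, and \<open>\<parallel>w\<parallel> \<le> \<parallel>x\<parallel>\<close>.
\<close>

lemma square_zero_half_plane:
  fixes N :: "'a::complex_hilbert_space \<Rightarrow>\<^sub>L 'a"
  assumes N: "clinear_op N" "N o\<^sub>L N = 0" and c: "cmod c = 1" and Nx: "N x \<noteq> 0"
    and half: "\<And>z. z \<in> numerical_range (scalar_op \<mu> + N) \<Longrightarrow> 0 \<le> Re (c * z)"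
  shows "norm (N x) \<le> 2 * Re (c * \<mu>) * norm x"
proof -
  obtain s w where *: "x = s *\<^sub>C N x + w" "cinner (N x) w = 0" "N w = N x" "N (N x) = 0"
    using square_zero_decomposition[OF N] by metis
  have w: "w \<noteq> 0"
    using *(3) Nx by auto
  define Y W where "Y = norm (N x)" and "W = norm w"
  have YW: "0 < Y" "0 < W"
    using Nx w by (auto simp: Y_def W_def)
  have "W\<^sup>2 \<le> (norm x)\<^sup>2"
    using norm_add_orthogonal[of "s *\<^sub>C N x" w] *(1,2) by (simp add: cinner_scaleC_left W_def)
  then have Wx: "W \<le> norm x"
    by (rule power2_le_imp_le) simp
  define k where "k = 1 / sqrt 2"
  have k: "complex_of_real k * complex_of_real k = 1 / 2"
    by (simp add: k_def flip: of_real_mult)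
  have kW: "cmod (complex_of_real (k / W)) = k / W"
    using YW by (subst norm_of_real) (simp add: k_def)
  \<comment> \<open>The form depends on \<open>cnj p\<close>: the phase \<open>- c\<close> shifts its value from \<open>\<mu>\<close> in the direction \<open>- cnj c\<close>,\<close>
  \<comment> \<open>which is the outward normal of the half-plane.\<close>
  define p where "p = - c * complex_of_real (k / Y)"
  define v where "v = p *\<^sub>C N x + complex_of_real (k / W) *\<^sub>C w"
  have "(norm v)\<^sup>2 = (cmod p * Y)\<^sup>2 + (k / W * W)\<^sup>2"
    unfolding v_def using *(2) YW kW
    by (subst norm_add_orthogonal)
      (auto simp: cinner_scaleC_left cinner_scaleC_right norm_scaleC simp flip: Y_def W_def)
  also have "\<dots> = 1"
    using YW c by (simp add: p_def norm_mult norm_divide k_def power_divide)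
  finally have v: "norm v = 1"
    using norm_ge_zero[of v] unfolding power2_eq_1_iff by linarith
  have Nv: "N v = complex_of_real (k / W) *\<^sub>C N x"
  proof -
    have "N v = p *\<^sub>C N (N x) + complex_of_real (k / W) *\<^sub>C N w"
      using N(1) by (simp only: v_def blinfun.add_right clinear_op_def)
    then show ?thesis
      by (simp add: *(3,4))
  qed
  have "cinner (N v) v = complex_of_real (k / W) * (cnj p * complex_of_real (Y\<^sup>2))"
    by (subst Nv) (simp add: v_def cinner_scaleC_left cinner_scaleC_right cinner_add_right *(2)
        cinner_self Y_def)
  also have "\<dots> = - cnj c * (complex_of_real k * complex_of_real k) * complex_of_real (Y / W)"
    using YW by (simp add: p_def power2_eq_square)
  also have "\<dots> = - cnj c * complex_of_real (Y / (2 * W))"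
    unfolding k by simp
  finally have "cinner ((scalar_op \<mu> + N) v) v = \<mu> - cnj c * complex_of_real (Y / (2 * W))"
    by (simp add: blinfun.add_left cinner_add_left cinner_scaleC_left cinner_self v)
  then have "\<mu> - cnj c * complex_of_real (Y / (2 * W)) \<in> numerical_range (scalar_op \<mu> + N)"
    unfolding numerical_range_def using v by force
  from half[OF this] have "0 \<le> Re (c * \<mu> - (c * cnj c) * complex_of_real (Y / (2 * W)))"
    by (simp add: algebra_simps)
  also have "c * cnj c = 1"
    using c complex_norm_square[of c] by simp
  finally have le: "Y / (2 * W) \<le> Re (c * \<mu>)"
    by simp
  have "0 \<le> Y / (2 * W)"
    using YW by simp
  also note le
  finally have "2 * Re (c * \<mu>) * W \<le> 2 * Re (c * \<mu>) * norm x"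
    using Wx by (intro mult_left_mono) auto
  moreover have "Y \<le> 2 * Re (c * \<mu>) * W"
    using le YW by (simp add: field_simps del: times_complex.sel)
  ultimately show ?thesis
    by (simp add: Y_def)
qed

section \<open>The Schwarz--Pick inequality in a sector\<close>

text \<open>
  Schwarz's lemma applies to a Moebius transform of \<open>F\<close>, which needs values strictly inside the disc;
  shrinking \<open>F\<close> by a factor \<open>r < 1\<close> and letting \<open>r\<close> tend to \<open>1\<close> covers the closed disc as well.
\<close>

lemma Schwarz_Pick_centre:
  assumes hol: "F holomorphic_on ball 0 1" and le: "\<And>z. cmod z < 1 \<Longrightarrow> cmod (F z) \<le> 1"
  shows "cmod (deriv F 0) \<le> 1 - (cmod (F 0))\<^sup>2"
proof -
  have F': "(F has_field_derivative deriv F 0) (at 0)"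
    using hol by (intro holomorphic_derivI[of _ "ball 0 1"]) auto
  have scaled: "r * cmod (deriv F 0) \<le> 1 - (r * cmod (F 0))\<^sup>2" if r: "0 < r" "r < 1" for r :: real
  proof -
    define a where "a = of_real r * F 0"
    have lt: "cmod (of_real r * F z) < 1" if "cmod z < 1" for z
    proof -
      have "cmod (of_real r * F z) \<le> r * 1"
        using le[OF that] r by (simp add: norm_mult mult_left_le)
      with r show ?thesis
        by linarith
    qed
    have a: "cmod a < 1"
      using lt[of 0] by (simp add: a_def)
    define d where "d = 1 - cnj a * a"
    have d: "d = of_real (1 - (cmod a)\<^sup>2)"
      using complex_norm_square[of a] by (simp add: d_def mult.commute)
    have d_pos: "0 < 1 - (cmod a)\<^sup>2"
      using a by (simp add: abs_square_less_1)
    then have d0: "d \<noteq> 0"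
      unfolding d of_real_eq_0_iff by simp
    define G where "G = (\<lambda>z. Moebius_function 0 a (of_real r * F z))"
    have "G holomorphic_on ball 0 1"
    proof -
      have "(\<lambda>z. of_real r * F z) holomorphic_on ball 0 1"
        using hol by (intro holomorphic_intros)
      then have "(Moebius_function 0 a \<circ> (\<lambda>z. of_real r * F z)) holomorphic_on ball 0 1"
        using Moebius_function_holomorphic[OF a]
        by (rule holomorphic_on_compose_gen) (use lt in auto)
      then show ?thesis
        by (simp add: G_def o_def)
    qed
    moreover have "G 0 = 0"
      by (simp add: G_def a_def Moebius_function_eq_zero)
    moreover have "cmod (G z) < 1" if "cmod z < 1" for z
      unfolding G_def using lt[OF that] a by (rule Moebius_function_norm_lt_1[rotated])
    ultimately have "cmod (deriv G 0) \<le> 1"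
      by (rule Schwarz_Lemma(2)[where \<xi> = 0]) auto
    moreover have "(Moebius_function 0 a has_field_derivative 1 / d) (at (of_real r * F 0))"
      unfolding Moebius_function_simple[abs_def] using d0
      by (auto intro!: derivative_eq_intros simp: d_def simp flip: a_def)
    then have "(G has_field_derivative 1 / d * (of_real r * deriv F 0)) (at 0)"
      unfolding G_def by (rule DERIV_chain2) (intro DERIV_cmult F')
    then have "deriv G 0 = of_real r * deriv F 0 / d"
      by (simp add: DERIV_imp_deriv)
    ultimately have "cmod (of_real r * deriv F 0) / cmod d \<le> 1"
      by (simp add: norm_divide)
    moreover have "cmod d = 1 - (cmod a)\<^sup>2"
      unfolding d norm_of_real using d_pos by simp
    ultimately have "r * cmod (deriv F 0) \<le> 1 - (cmod a)\<^sup>2"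
      using d_pos r by (simp add: norm_mult divide_le_eq_1)
    then show ?thesis
      using r by (simp add: a_def norm_mult)
  qed
  have "((\<lambda>r. r * cmod (deriv F 0)) \<longlongrightarrow> 1 * cmod (deriv F 0)) (at_left 1)"
    and "((\<lambda>r. 1 - (r * cmod (F 0))\<^sup>2) \<longlongrightarrow> 1 - (1 * cmod (F 0))\<^sup>2) (at_left 1)"
    by (intro tendsto_intros)+
  moreover have "\<forall>\<^sub>F r in at_left 1. r * cmod (deriv F 0) \<le> 1 - (r * cmod (F 0))\<^sup>2"
    using eventually_at_left_real[OF zero_less_one] by eventually_elim (auto intro: scaled)
  ultimately have "1 * cmod (deriv F 0) \<le> 1 - (1 * cmod (F 0))\<^sup>2"
    by (intro tendsto_le[of "at_left 1"]) auto
  then show ?thesis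
    by simp
qed

text \<open>
  The two real parts are the signed distances of a point to the lines through the edges, which turns
  membership in the sector into a pair of half-plane conditions.
\<close>

lemma Re_cis_mult_rcis:
  "Re (cis (pi / 2 - \<alpha>) * rcis r \<theta>) = r * sin (\<alpha> - \<theta>)"
  "Re (cnj (cis (pi / 2 - \<alpha>)) * rcis r \<theta>) = r * sin (\<alpha> + \<theta>)"
  by (simp_all add: rcis_def sin_diff sin_add cos_diff sin_diff cos_add algebra_simps)

text \<open>
  With \<open>- \<pi> < \<theta> \<le> \<pi>\<close> and \<open>\<alpha> \<le> \<pi>/2\<close>, an angle outside the sector is less than \<open>\<pi>\<close> away from the
  nearer edge, so that one of \<open>sin (\<alpha> - \<theta>)\<close>, \<open>sin (\<alpha> + \<theta>)\<close> is negative.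
\<close>

lemma
  assumes \<alpha>: "0 < \<alpha>" "\<alpha> \<le> pi / 2"
  shows mem_sector_iff: "z \<in> sector \<alpha> \<longleftrightarrow>
      0 \<le> Re (cis (pi / 2 - \<alpha>) * z) \<and> 0 \<le> Re (cnj (cis (pi / 2 - \<alpha>)) * z)" (is ?closed)
    and open_sector_polar: "0 < Re (cis (pi / 2 - \<alpha>) * z) \<and> 0 < Re (cnj (cis (pi / 2 - \<alpha>)) * z) \<longleftrightarrow>
      (\<exists>r \<theta>. 0 < r \<and> \<bar>\<theta>\<bar> < \<alpha> \<and> z = rcis r \<theta>)" (is ?open)
proof -
  define r t where "r = cmod z" and "t = Arg z"
  have z: "z = rcis r t"
    by (simp add: r_def t_def rcis_cmod_Arg)
  have r: "0 \<le> r" and t: "- pi < t" "t \<le> pi"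
    using Arg_bounded[of z] by (auto simp: r_def t_def)
  have big: "sin (\<alpha> - t) \<le> 0 \<or> sin (\<alpha> + t) \<le> 0" if "\<not> \<bar>t\<bar> < \<alpha>"
  proof (cases "\<alpha> \<le> t")
    case True
    then have "0 \<le> sin (t - \<alpha>)"
      using \<alpha> t by (intro sin_ge_zero) auto
    then show ?thesis
      using sin_minus[of "t - \<alpha>"] by simp
  next
    case False
    then have "0 \<le> sin (- (\<alpha> + t))"
      using \<alpha> t that by (intro sin_ge_zero) auto
    then show ?thesis
      by (simp only: sin_minus) simp
  qed
  have bigger: "sin (\<alpha> - t) < 0 \<or> sin (\<alpha> + t) < 0" if "\<not> \<bar>t\<bar> \<le> \<alpha>"
  proof (cases "\<alpha> < t")
    case True
    then have "0 < sin (t - \<alpha>)"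
      using \<alpha> t by (intro sin_gt_zero) auto
    then show ?thesis
      using sin_minus[of "t - \<alpha>"] by simp
  next
    case False
    then have "0 < sin (- (\<alpha> + t))"
      using \<alpha> t that by (intro sin_gt_zero) auto
    then show ?thesis
      by (simp only: sin_minus) simp
  qed
  show ?closed
  proof
    assume "z \<in> sector \<alpha>"
    then obtain r' t' where "z = rcis r' t'" "0 \<le> r'" "\<bar>t'\<bar> \<le> \<alpha>"
      by (auto simp: sector_def)
    then show "0 \<le> Re (cis (pi / 2 - \<alpha>) * z) \<and> 0 \<le> Re (cnj (cis (pi / 2 - \<alpha>)) * z)"
      unfolding Re_cis_mult_rcis using \<alpha> by (auto simp only: Re_cis_mult_rcis intro!: mult_nonneg_nonneg sin_ge_zero) 
  next
    assume "0 \<le> Re (cis (pi / 2 - \<alpha>) * z) \<and> 0 \<le> Re (cnj (cis (pi / 2 - \<alpha>)) * z)"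
    then have *: "0 \<le> r * sin (\<alpha> - t)" "0 \<le> r * sin (\<alpha> + t)"
      by (simp_all only: z Re_cis_mult_rcis)
    show "z \<in> sector \<alpha>"
    proof (cases "r = 0")
      case True
      then show ?thesis
        unfolding sector_def using z \<alpha> by (auto intro!: exI[of _ 0])
    next
      case False
      then have "\<bar>t\<bar> \<le> \<alpha>"
        using * r bigger by (auto simp: zero_le_mult_iff)
      then show ?thesis
        unfolding sector_def using z r by blast
    qed
  qed
  show ?open
  proof
    assume "\<exists>r \<theta>. 0 < r \<and> \<bar>\<theta>\<bar> < \<alpha> \<and> z = rcis r \<theta>"
    then obtain r' t' where "z = rcis r' t'" "0 < r'" "\<bar>t'\<bar> < \<alpha>"
      by auto
    then show "0 < Re (cis (pi / 2 - \<alpha>) * z) \<and> 0 < Re (cnj (cis (pi / 2 - \<alpha>)) * z)"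
      using \<alpha> by (auto simp only: Re_cis_mult_rcis intro!: mult_pos_pos sin_gt_zero)
  next
    assume "0 < Re (cis (pi / 2 - \<alpha>) * z) \<and> 0 < Re (cnj (cis (pi / 2 - \<alpha>)) * z)"
    then have "0 < r * sin (\<alpha> - t)" "0 < r * sin (\<alpha> + t)"
      by (simp_all only: z Re_cis_mult_rcis)
    then have "0 < r" "0 < sin (\<alpha> - t)" "0 < sin (\<alpha> + t)"
      using r by (auto simp: zero_less_mult_iff)
    then show "\<exists>r \<theta>. 0 < r \<and> \<bar>\<theta>\<bar> < \<alpha> \<and> z = rcis r \<theta>"
      using big z by force
  qed
qed

lemma
  assumes \<alpha>: "0 < \<alpha>" "\<alpha> \<le> pi / 2"
  shows mem_interior_sector_iff: "z \<in> interior (sector \<alpha>) \<longleftrightarrow>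
      0 < Re (cis (pi / 2 - \<alpha>) * z) \<and> 0 < Re (cnj (cis (pi / 2 - \<alpha>)) * z)"
    and convex_sector: "convex (sector \<alpha>)"
    and closed_sector: "closed (sector \<alpha>)"
proof -
  define c where "c = cis (pi / 2 - \<alpha>)"
  have S: "sector \<alpha> = {z. c \<bullet> z \<ge> 0} \<inter> {z. cnj c \<bullet> z \<ge> 0}"
    using mem_sector_iff[OF \<alpha>] by (auto simp: c_def inner_complex_def)
  have [simp]: "c \<noteq> 0"
    by (simp add: c_def)
  show "z \<in> interior (sector \<alpha>) \<longleftrightarrow>
      0 < Re (cis (pi / 2 - \<alpha>) * z) \<and> 0 < Re (cnj (cis (pi / 2 - \<alpha>)) * z)"
    unfolding S interior_Int c_def[symmetric]
    by simp (auto simp: inner_complex_def)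
  show "convex (sector \<alpha>)"
    unfolding S by (intro convex_Int convex_halfspace_ge)
  show "closed (sector \<alpha>)"
    unfolding S by (intro closed_Int closed_halfspace_ge)
qed

lemma mem_interior_sector_polar:
  assumes "0 < \<alpha>" "\<alpha> \<le> pi / 2"
  shows "z \<in> interior (sector \<alpha>) \<longleftrightarrow> (\<exists>r \<theta>. 0 < r \<and> \<bar>\<theta>\<bar> < \<alpha> \<and> z = rcis r \<theta>)"
  by (simp only: mem_interior_sector_iff[OF assms] open_sector_polar[OF assms])

text \<open>
  The map \<open>w \<mapsto> r ((e\<^sup>i\<^sup>\<beta> + e\<^sup>-\<^sup>i\<^sup>\<beta> w) / (1 - w))\<^sup>1\<^sup>/\<^sup>p\<close> with \<open>\<beta> = p \<theta>\<close> sends the disc onto the sector, by way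
  of the right half-plane, and its centre to \<open>r e\<^sup>i\<^sup>\<theta>\<close>. Its derivative at the centre has modulus
  \<open>2 r cos (p \<theta>) / p\<close>, the reciprocal of the hyperbolic density of the sector.
\<close>

lemma Schwarz_Pick_sector:
  assumes \<alpha>: "0 < \<alpha>" "\<alpha> \<le> pi / 2" and p: "p = pi / (2 * \<alpha>)"
    and hol: "f holomorphic_on interior (sector \<alpha>)"
    and le: "\<And>z. z \<in> interior (sector \<alpha>) \<Longrightarrow> cmod (f z) \<le> 1"
    and r: "0 < r" and \<theta>: "\<bar>\<theta>\<bar> < \<alpha>"
  shows "cmod (deriv f (rcis r \<theta>)) * (2 * r * cos (p * \<theta>) / p) \<le> 1 - (cmod (f (rcis r \<theta>)))\<^sup>2"
proof -
  have p_pos: "0 < p"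
    using \<alpha> by (simp add: p)
  define \<beta> where "\<beta> = p * \<theta>"
  have \<beta>: "\<bar>\<beta>\<bar> < pi / 2"
  proof -
    have "\<bar>\<beta>\<bar> < p * \<alpha>"
      using \<theta> p_pos by (simp add: \<beta>_def abs_mult)
    also have "p * \<alpha> = pi / 2"
      using \<alpha> by (simp add: p)
    finally show ?thesis .
  qed
  have cos_pos: "0 < cos \<beta>"
    using \<beta> by (intro cos_gt_zero_pi) auto
  define \<kappa> where "\<kappa> = (\<lambda>w. (cis \<beta> + cis (- \<beta>) * w) / (1 - w))"
  define \<psi> where "\<psi> = (\<lambda>w. of_real r * exp (of_real (1 / p) * Ln (\<kappa> w)))"
  have ne1: "w \<noteq> 1" if "cmod w < 1" for w
    using that by auto
  have Re_\<kappa>: "0 < Re (\<kappa> w)" if w: "cmod w < 1" for w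
  proof -
    have "\<kappa> w = (cis \<beta> + cis (- \<beta>) * w) * cnj (1 - w) / of_real ((cmod (1 - w))\<^sup>2)"
      unfolding \<kappa>_def using ne1[OF w]
      by (subst complex_norm_square) (simp del: complex_cnj_diff)
    then have "Re (\<kappa> w) = Re ((cis \<beta> + cis (- \<beta>) * w) * cnj (1 - w)) / (cmod (1 - w))\<^sup>2"
      by (simp only: Re_divide_of_real)
    also have "Re ((cis \<beta> + cis (- \<beta>) * w) * cnj (1 - w)) = cos \<beta> * (1 - (cmod w)\<^sup>2)"
      unfolding cmod_power2 by (simp add: algebra_simps power2_eq_square)
    finally show ?thesis
      using cos_pos w ne1[OF w] by (simp add: abs_square_less_1)
  qed
  have \<kappa>_ne: "\<kappa> w \<notin> \<real>\<^sub>\<le>\<^sub>0" if "cmod w < 1" for w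
    using Re_\<kappa>[OF that] by (auto simp: complex_nonpos_Reals_iff)
  have \<psi>_sector: "\<psi> w \<in> interior (sector \<alpha>)" if w: "cmod w < 1" for w
  proof -
    have "\<kappa> w \<noteq> 0"
      using Re_\<kappa>[OF w] by auto
    then have "\<bar>Im (Ln (\<kappa> w))\<bar> < pi / 2"
      using Re_\<kappa>[OF w] Re_Ln_pos_lt by blast
    then have "\<bar>Im (of_real (1 / p) * Ln (\<kappa> w))\<bar> < \<alpha>"
      using p_pos \<alpha> by (simp add: abs_mult p field_simps)
    moreover have "\<psi> w = rcis (r * exp (Re (of_real (1 / p) * Ln (\<kappa> w))))
        (Im (of_real (1 / p) * Ln (\<kappa> w)))"
      unfolding \<psi>_def by (subst exp_eq_polar) (simp add: rcis_def exp_of_real)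
    ultimately show ?thesis
      unfolding mem_interior_sector_polar[OF \<alpha>] using r
      by (intro exI[of _ "r * exp (Re (of_real (1 / p) * Ln (\<kappa> w)))"]
          exI[of _ "Im (of_real (1 / p) * Ln (\<kappa> w))"]) auto
  qed
  have \<kappa>_hol: "\<kappa> holomorphic_on ball 0 1"
    unfolding \<kappa>_def using ne1 by (intro holomorphic_intros) auto
  have \<psi>_hol: "\<psi> holomorphic_on ball 0 1"
    unfolding \<psi>_def using \<kappa>_ne \<kappa>_hol by (intro holomorphic_intros) auto
  have \<kappa>0: "\<kappa> 0 = cis \<beta>"
    by (simp add: \<kappa>_def)
  have Ln\<kappa>0: "Ln (\<kappa> 0) = \<i> * of_real \<beta>"
    unfolding \<kappa>0 cis_conv_exp using \<beta> by (intro Ln_exp) auto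
  have \<psi>0: "\<psi> 0 = rcis r \<theta>"
    using p_pos by (simp add: \<psi>_def Ln\<kappa>0 rcis_def cis_conv_exp \<beta>_def)
  have \<kappa>': "(\<kappa> has_field_derivative of_real (2 * cos \<beta>)) (at 0)"
  proof -
    have "(\<kappa> has_field_derivative cis (- \<beta>) + cis \<beta>) (at 0)"
      unfolding \<kappa>_def by (auto intro!: derivative_eq_intros)
    also have "cis (- \<beta>) + cis \<beta> = of_real (2 * cos \<beta>)"
      by (simp add: complex_eq_iff)
    finally show ?thesis .
  qed
  have \<psi>': "(\<psi> has_field_derivative \<psi> 0 * of_real (1 / p) * (of_real (2 * cos \<beta>) / \<kappa> 0)) (at 0)"
    unfolding \<psi>_def using \<kappa>_ne[of 0] p_pos
    by (auto intro!: derivative_eq_intros \<kappa>' simp: field_simps)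
  have mod\<psi>': "cmod (deriv \<psi> 0) = 2 * r * cos (p * \<theta>) / p"
  proof -
    have "cmod (deriv \<psi> 0) = cmod (\<psi> 0) * (1 / p) * (cmod (of_real (2 * cos \<beta>)) / cmod (\<kappa> 0))"
      using p_pos by (simp add: DERIV_imp_deriv[OF \<psi>'] norm_mult norm_divide)
    also have "cmod (of_real (2 * cos \<beta>)) = 2 * cos \<beta>"
      unfolding norm_of_real using cos_pos by simp
    finally show ?thesis
      using r by (simp add: \<psi>0 \<kappa>0 rcis_def norm_mult \<beta>_def)
  qed
  have comp_hol: "f \<circ> \<psi> holomorphic_on ball 0 1"
    using \<psi>_sector by (intro holomorphic_on_compose_gen[OF \<psi>_hol hol]) auto
  have "deriv (f \<circ> \<psi>) 0 = deriv f (\<psi> 0) * deriv \<psi> 0"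
  proof (rule deriv_chain)
    show "\<psi> field_differentiable at 0"
      using \<psi>' by (auto simp: field_differentiable_def)
    show "f field_differentiable at (\<psi> 0)"
      using hol \<psi>_sector[of 0] by (intro holomorphic_on_imp_differentiable_at) auto
  qed
  moreover have "cmod (deriv (f \<circ> \<psi>) 0) \<le> 1 - (cmod ((f \<circ> \<psi>) 0))\<^sup>2"
    using le \<psi>_sector by (intro Schwarz_Pick_centre[OF comp_hol]) auto
  ultimately show ?thesis
    by (simp add: norm_mult mod\<psi>' \<psi>0)
qed

text \<open>
  The quotient \<open>sin t / sin (p t)\<close> increases on \<open>(0, \<alpha>]\<close>: its derivative has the sign of
  \<open>cos t sin (p t) - p sin t cos (p t)\<close>, which vanishes at \<open>0\<close> and has the derivative
  \<open>(p\<^sup>2 - 1) sin t sin (p t)\<close>. At \<open>t = \<alpha>\<close> the quotient is \<open>sin \<alpha>\<close>.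
\<close>

lemma sin_le_sin_mult:
  fixes \<alpha> t :: real
  assumes \<alpha>: "0 < \<alpha>" "\<alpha> \<le> pi / 2" and p: "p = pi / (2 * \<alpha>)" and t: "0 \<le> t" "t \<le> \<alpha>"
  shows "sin t \<le> sin \<alpha> * sin (p * t)"
proof (cases "t = 0")
  case False
  then have t0: "0 < t"
    using t by simp
  have p1: "1 \<le> p"
    using \<alpha> by (simp add: p field_simps)
  have p\<alpha>: "p * \<alpha> = pi / 2"
    using \<alpha> by (simp add: p)
  have px: "p * x \<le> pi / 2" if "x \<le> \<alpha>" for x
    using that p1 by (simp flip: p\<alpha>)
  have sin_nonneg: "0 \<le> sin x" "0 \<le> sin (p * x)" if "0 \<le> x" "x \<le> \<alpha>" for x
    using that p1 \<alpha> px[of x] pi_gt_zero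
    by (intro sin_ge_zero; force intro: order_trans[of _ "pi / 2"])+
  have sin_pos: "0 < sin (p * x)" if "0 < x" "x \<le> \<alpha>" for x
    using that p1 by (intro sin_gt_zero order.strict_trans1[OF px]) auto
  define h where "h = (\<lambda>x. cos x * sin (p * x) - p * sin x * cos (p * x))"
  have h: "0 \<le> h x" if x: "0 \<le> x" "x \<le> \<alpha>" for x
  proof -
    have "h 0 \<le> h x"
    proof (rule DERIV_nonneg_imp_nondecreasing[OF x(1)])
      fix y assume y: "0 \<le> y" "y \<le> x"
      have "(h has_real_derivative (p\<^sup>2 - 1) * (sin y * sin (p * y))) (at y)"
        unfolding h_def
        by (auto intro!: derivative_eq_intros simp: algebra_simps power2_eq_square)
      moreover have "0 \<le> (p\<^sup>2 - 1) * (sin y * sin (p * y))"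
        using p1 y x sin_nonneg[of y] by (intro mult_nonneg_nonneg) auto
      ultimately show "\<exists>D. (h has_real_derivative D) (at y) \<and> 0 \<le> D"
        by blast
    qed
    then show ?thesis
      by (simp add: h_def)
  qed
  have "sin t / sin (p * t) \<le> sin \<alpha> / sin (p * \<alpha>)"
  proof (rule DERIV_nonneg_imp_nondecreasing[OF t(2)])
    fix x assume x: "t \<le> x" "x \<le> \<alpha>"
    then have pos: "0 < sin (p * x)"
      using t0 by (intro sin_pos) auto
    have "((\<lambda>x. sin x / sin (p * x)) has_real_derivative h x / (sin (p * x))\<^sup>2) (at x)"
      using pos unfolding h_def
      by (auto intro!: derivative_eq_intros simp: algebra_simps power2_eq_square)
    moreover have "0 \<le> h x / (sin (p * x))\<^sup>2"
      using h[of x] x t by simp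
    ultimately show "\<exists>D. ((\<lambda>x. sin x / sin (p * x)) has_real_derivative D) (at x) \<and> 0 \<le> D"
      by blast
  qed
  then show ?thesis
    using sin_pos[OF t0 t(2)] unfolding p\<alpha> by (simp add: field_simps)
qed simp

lemma one_le_sector_constant:
  assumes "0 < \<alpha>" "\<alpha> \<le> pi / 2"
  shows "1 \<le> pi * sin \<alpha> / (2 * \<alpha>)"
proof -
  have "concave_on {0..pi / 2} (sin :: real \<Rightarrow> real)"
    by (rule f''_le0_imp_concave[of _ _ cos "\<lambda>x. - sin x"])
      (auto intro!: derivative_eq_intros sin_ge_zero)
  from concave_onD_Icc'[OF this, of \<alpha>] assms have "2 * \<alpha> / pi \<le> sin \<alpha>"
    by simp
  then show ?thesis
    using assms by (simp add: field_simps)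
qed

text \<open>
  The distance of \<open>r e\<^sup>i\<^sup>\<theta>\<close> to the edge of the sector is \<open>r sin (\<alpha> - \<bar>\<theta>\<bar>)\<close>, and
  \<open>cos (p \<theta>) = sin (p (\<alpha> - \<bar>\<theta>\<bar>))\<close> as \<open>p \<alpha> = \<pi>/2\<close>, so that the preceding estimate compares the
  Euclidean and the hyperbolic scale; it is sharp on the axis \<open>\<theta> = 0\<close>.
\<close>

lemma deriv_bound_sector:
  assumes \<alpha>: "0 < \<alpha>" "\<alpha> \<le> pi / 2"
    and hol: "f holomorphic_on interior (sector \<alpha>)"
    and le: "\<And>z. z \<in> interior (sector \<alpha>) \<Longrightarrow> cmod (f z) \<le> 1"
    and \<mu>: "\<mu> \<in> interior (sector \<alpha>)"
    and d: "d \<le> 2 * Re (cis (pi / 2 - \<alpha>) * \<mu>)" "d \<le> 2 * Re (cnj (cis (pi / 2 - \<alpha>)) * \<mu>)"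
  shows "cmod (deriv f \<mu>) * d \<le> pi * sin \<alpha> / (2 * \<alpha>) * (1 - (cmod (f \<mu>))\<^sup>2)"
proof -
  define p where "p = pi / (2 * \<alpha>)"
  have p_pos: "0 < p"
    using \<alpha> by (simp add: p_def)
  obtain r \<theta> where \<mu>: "0 < r" "\<bar>\<theta>\<bar> < \<alpha>" "\<mu> = rcis r \<theta>"
    using \<mu> unfolding mem_interior_sector_polar[OF \<alpha>] by blast
  have "d \<le> 2 * (r * sin (\<alpha> - \<bar>\<theta>\<bar>))"
    using d unfolding \<mu>(3) Re_cis_mult_rcis by (cases "0 \<le> \<theta>") auto
  also have "\<dots> \<le> 2 * (r * (sin \<alpha> * sin (p * (\<alpha> - \<bar>\<theta>\<bar>))))"
    using \<mu> sin_le_sin_mult[OF \<alpha> p_def, of "\<alpha> - \<bar>\<theta>\<bar>"] by (intro mult_left_mono) auto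
  also have "sin (p * (\<alpha> - \<bar>\<theta>\<bar>)) = cos (p * \<theta>)"
  proof -
    have "p * (\<alpha> - \<bar>\<theta>\<bar>) = pi / 2 - \<bar>p * \<theta>\<bar>"
      using \<alpha> by (simp add: p_def abs_mult field_simps)
    then show ?thesis
      by (simp add: sin_diff)
  qed
  finally have "cmod (deriv f \<mu>) * d \<le> cmod (deriv f \<mu>) * (2 * (r * (sin \<alpha> * cos (p * \<theta>))))"
    by (intro mult_left_mono) auto
  also have "\<dots> = p * sin \<alpha> * (cmod (deriv f \<mu>) * (2 * r * cos (p * \<theta>) / p))"
    using p_pos by (simp add: field_simps)
  also have "\<dots> \<le> p * sin \<alpha> * (1 - (cmod (f \<mu>))\<^sup>2)"
    using Schwarz_Pick_sector[OF \<alpha> p_def hol le \<mu>(1,2)] p_pos \<alpha> sin_gt_zero[of \<alpha>]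
    by (intro mult_left_mono) (auto simp: \<mu>(3))
  finally show ?thesis
    by (simp add: p_def)
qed

lemma sector_fun_bound:
  assumes "sector_fun \<alpha> f" "z \<in> sector \<alpha>"
  shows "cmod (f z) \<le> 1"
proof -
  let ?X = "Alexandroff_compactification (top_of_set (sector \<alpha>))"
  obtain L where L: "continuous_map ?X euclidean (case_option L f)"
    and sup: "(SUP z\<in>sector \<alpha>. cmod (f z)) \<le> 1"
    using assms(1) by (auto simp: sector_fun_def)
  have "compactin ?X (topspace ?X)"
    by (rule compact_space_Alexandroff_compactification[unfolded compact_space_def])
  from image_compactin[OF this L] have "compact (case_option L f ` topspace ?X)"
    by simp
  then have "bounded (f ` sector \<alpha>)"
    by (rule bounded_subset[OF compact_imp_bounded]) (force simp: image_image)
  then have "bdd_above ((\<lambda>z. cmod (f z)) ` sector \<alpha>)"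
    by (auto simp: bounded_iff bdd_above_def)
  from cSUP_upper[OF assms(2) this] sup show ?thesis
    by linarith
qed

section \<open>The functional calculus of a square-zero perturbation of a scalar\<close>

lemma scalar_op_compose_id: "scalar_op c o\<^sub>L id_blinfun = scalar_op c"
  by (rule blinfun_eqI) simp

lemma scalar_op_add: "scalar_op (c + d) = scalar_op c + scalar_op d"
  by (rule blinfun_eqI) (simp add: blinfun.add_left scaleC_add_left)

lemma bounded_linear_scalar_op:
  "bounded_linear (scalar_op :: complex \<Rightarrow> 'a::complex_hilbert_space \<Rightarrow>\<^sub>L 'a)"
proof
  fix c d :: complex and r :: real
  show "scalar_op (c + d) = (scalar_op c + scalar_op d :: 'a \<Rightarrow>\<^sub>L 'a)"
    by (rule scalar_op_add)
  show "scalar_op (r *\<^sub>R c) = (r *\<^sub>R scalar_op c :: 'a \<Rightarrow>\<^sub>L 'a)"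
    by (rule blinfun_eqI)
      (simp add: blinfun.scaleR_left scaleR_scaleC scaleC_scaleC scaleC_complex_def)
  show "\<exists>K. \<forall>c. norm (scalar_op c :: 'a \<Rightarrow>\<^sub>L 'a) \<le> norm c * K"
    using norm_scalar_op_le by (intro exI[of _ 1]) auto
qed

lemma clinear_op_minus_scalar:
  assumes "clinear_op B" "B = scalar_op \<mu> + N"
  shows "clinear_op N"
proof -
  have N: "N x = B x + - 1 *\<^sub>C (\<mu> *\<^sub>C x)" for x
  proof -
    have "(\<mu> *\<^sub>C x) + - 1 *\<^sub>C (\<mu> *\<^sub>C x) = (1 + - 1) *\<^sub>C (\<mu> *\<^sub>C x)"
      by (simp only: scaleC_add_left scaleC_one)
    then show ?thesis
      by (simp add: assms(2) blinfun.add_left)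
  qed
  show ?thesis
    using assms(1) unfolding clinear_op_def N
    by (simp add: scaleC_add_right scaleC_scaleC mult.commute)
qed

lemma is_inverse_op_unique:
  assumes "is_inverse_op T R" "is_inverse_op T R'"
  shows "R = R'"
proof (rule blinfun_eqI)
  fix x
  have "T (R' x) = x" and "\<And>y. R (T y) = y"
    using assms unfolding is_inverse_op_def
    by (metis blinfun_apply_blinfun_compose blinfun_apply_id_blinfun)+
  then show "R x = R' x"
    by metis
qed

lemma resolvent_square_zero:
  fixes N :: "'a::complex_hilbert_space \<Rightarrow>\<^sub>L 'a"
  assumes N: "clinear_op N" "N o\<^sub>L N = 0" and z: "z \<noteq> \<mu>"
  defines "R \<equiv> scalar_op (1 / (z - \<mu>)) + (scalar_op (1 / (z - \<mu>)\<^sup>2) o\<^sub>L N)"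
  shows "is_inverse_op (scalar_op z - (scalar_op \<mu> + N)) R"
    and "resolvent (scalar_op \<mu> + N) z = R"
proof -
  let ?T = "scalar_op z - (scalar_op \<mu> + N)"
  define d where "d = z - \<mu>"
  have d: "d \<noteq> 0"
    using z by (simp add: d_def)
  have NN: "N (N x) = 0" for x
    using arg_cong[OF N(2), of "\<lambda>S. blinfun_apply S x"] by simp
  have Nc: "N (c *\<^sub>C x) = c *\<^sub>C N x" for c x
    using N(1) by (simp add: clinear_op_def)
  have "z *\<^sub>C x = d *\<^sub>C x + \<mu> *\<^sub>C x" for x :: 'a
    by (simp add: d_def flip: scaleC_add_left)
  then have T: "?T x = d *\<^sub>C x - N x" for x
    by (simp add: blinfun.diff_left blinfun.add_left)
  have R: "R x = (1 / d) *\<^sub>C x + (1 / d\<^sup>2) *\<^sub>C N x" for x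
    by (simp add: R_def d_def blinfun.add_left)
  show inv: "is_inverse_op ?T R"
    unfolding is_inverse_op_def
  proof (intro conjI blinfun_eqI)
    fix x
    have "R (d *\<^sub>C x - N x) = x + ((1 / d\<^sup>2 * d) *\<^sub>C N x - (1 / d) *\<^sub>C N x)"
      using d by (simp add: blinfun.diff_right) (simp add: R Nc NN scaleC_scaleC)
    then show "(R o\<^sub>L ?T) x = id_blinfun x"
      using d by (simp add: T power2_eq_square)
    have "d *\<^sub>C R x - N (R x) = x + ((d * (1 / d\<^sup>2)) *\<^sub>C N x - (1 / d) *\<^sub>C N x)"
      using d by (simp add: R blinfun.add_right Nc NN scaleC_scaleC scaleC_add_right)
    then show "(?T o\<^sub>L R) x = id_blinfun x"
      using d by (simp add: T power2_eq_square)
  qed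
  show "resolvent (scalar_op \<mu> + N) z = R"
    unfolding resolvent_def by (rule the_equality) (use inv is_inverse_op_unique in blast)+
qed

lemma spectrum_square_zero:
  fixes N :: "'a::complex_hilbert_space \<Rightarrow>\<^sub>L 'a"
  assumes nontriv: "(v :: 'a) \<noteq> 0" and N: "clinear_op N" "N o\<^sub>L N = 0"
  shows "spectrum (scalar_op \<mu> + N) = {\<mu>}"
proof -
  have "\<not> is_inverse_op (scalar_op \<mu> - (scalar_op \<mu> + N)) R" for R
  proof
    assume "is_inverse_op (scalar_op \<mu> - (scalar_op \<mu> + N)) R"
    then have "(scalar_op \<mu> - (scalar_op \<mu> + N)) o\<^sub>L R = id_blinfun"
      by (simp add: is_inverse_op_def)
    from arg_cong[OF this, of "\<lambda>S. blinfun_apply S x" for x] have inv: "- N (R x) = x" for x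
      by (simp add: blinfun.minus_left)
    have "N x = 0" for x
      using arg_cong[OF inv[of x], of "blinfun_apply N"]
        arg_cong[OF N(2), of "\<lambda>S. blinfun_apply S (R x)"]
      by (simp add: blinfun.minus_right)
    then show False
      using inv[of v] nontriv by simp
  qed
  moreover have "z \<notin> spectrum (scalar_op \<mu> + N)" if "z \<noteq> \<mu>" for z
    unfolding spectrum_def using resolvent_square_zero(1)[OF N that] by blast
  ultimately show ?thesis
    unfolding spectrum_def by blast
qed

lemma calculus_contour_exists:
  assumes "open U" "\<mu> \<in> U" "spectrum B = {\<mu>}"
  shows "\<exists>\<gamma>. calculus_contour U B \<gamma>"
proof -
  obtain e where e: "0 < e" "cball \<mu> e \<subseteq> U"
    using assms(1,2) open_contains_cball by blast
  have "calculus_contour U B (circlepath \<mu> e)"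
    unfolding calculus_contour_def
  proof (intro conjI ballI allI impI)
    show "path_image (circlepath \<mu> e) \<subseteq> U - spectrum B"
      using e assms(3) by auto
    show "winding_number (circlepath \<mu> e) z = 1" if "z \<in> spectrum B" for z
      using that assms(3) e by (simp add: winding_number_circlepath)
    show "winding_number (circlepath \<mu> e) z = 0" if "z \<notin> U" for z
      using that e by (intro winding_number_zero_outside[of _ "cball \<mu> e"]) auto
  qed auto
  then show ?thesis
    by blast
qed

lemma op_integrand_has_integral:
  assumes "(f has_contour_integral i) \<gamma>"
  shows "((\<lambda>t. scalar_op (f (\<gamma> t) * vector_derivative \<gamma> (at t within {0..1})) o\<^sub>L X)
      has_integral (scalar_op i o\<^sub>L X)) {0..1}"
proof -
  have "bounded_linear (\<lambda>c. scalar_op c o\<^sub>L X)"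
    by (rule bounded_linear_compose[OF bounded_bilinear.bounded_linear_left[OF
          bounded_bilinear_blinfun_compose] bounded_linear_scalar_op])
  from has_integral_linear[OF assms[unfolded has_contour_integral_def] this]
  show ?thesis
    by (simp add: o_def)
qed

lemma Cauchy_integral_over_power:
  assumes U: "open U" "connected U" and f: "f holomorphic_on U" and \<mu>: "\<mu> \<in> U"
    and \<gamma>: "valid_path \<gamma>" "pathfinish \<gamma> = pathstart \<gamma>" "path_image \<gamma> \<subseteq> U - {\<mu>}"
    and wind: "winding_number \<gamma> \<mu> = 1" "\<And>z. z \<notin> U \<Longrightarrow> winding_number \<gamma> z = 0"
  shows "((\<lambda>z. f z / (z - \<mu>) ^ Suc n) has_contour_integral
      2 * of_real pi * \<i> * ((deriv ^^ n) f \<mu> / fact n)) \<gamma>"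
proof -
  have hol: "(\<lambda>z. f z / (z - \<mu>) ^ Suc n) holomorphic_on U - {\<mu>}"
    by (intro holomorphic_intros holomorphic_on_subset[OF f]) auto
  have "contour_integral \<gamma> (\<lambda>z. f z / (z - \<mu>) ^ Suc n) =
      2 * of_real pi * \<i> * ((deriv ^^ n) f \<mu> / fact n)"
    using Residue_theorem[OF U, of "{\<mu>}", OF _ hol \<gamma>] wind
    by (simp add: residue_holomorphic_over_power[OF U(1) \<mu> f] del: power_Suc)
  moreover have "(\<lambda>z. f z / (z - \<mu>) ^ Suc n) contour_integrable_on \<gamma>"
    using hol U(1) \<gamma> by (intro contour_integrable_holomorphic_simple[of _ "U - {\<mu>}"]) auto
  ultimately show ?thesis
    using has_contour_integral_integral by metis
qed

text \<open>
  The resolvent \<open>(z - \<mu>)\<^sup>-\<^sup>1 I + (z - \<mu>)\<^sup>-\<^sup>2 N\<close> reduces the operator integral to two scalar ones,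
  which Cauchy's formula evaluates to \<open>f \<mu>\<close> and \<open>f' \<mu>\<close> on any admissible contour.
\<close>

theorem hol_calculus_square_zero:
  fixes N :: "'a::complex_hilbert_space \<Rightarrow>\<^sub>L 'a"
  assumes nontriv: "(v :: 'a) \<noteq> 0" and N: "clinear_op N" "N o\<^sub>L N = 0"
    and U: "open U" "connected U" and f: "f holomorphic_on U" and \<mu>: "\<mu> \<in> U"
  shows "hol_calculus U f (scalar_op \<mu> + N) = scalar_op (f \<mu>) + (scalar_op (deriv f \<mu>) o\<^sub>L N)"
proof -
  let ?B = "scalar_op \<mu> + N"
  define \<gamma> where "\<gamma> = (SOME \<gamma>. calculus_contour U ?B \<gamma>)"
  define k where "k = 2 * complex_of_real pi * \<i>"
  have spec: "spectrum ?B = {\<mu>}"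
    by (rule spectrum_square_zero[OF nontriv N])
  have "calculus_contour U ?B \<gamma>"
    unfolding \<gamma>_def using calculus_contour_exists[OF U(1) \<mu> spec] by (rule someI_ex)
  then have \<gamma>: "valid_path \<gamma>" "pathfinish \<gamma> = pathstart \<gamma>" "path_image \<gamma> \<subseteq> U - {\<mu>}"
      "winding_number \<gamma> \<mu> = 1" "\<And>z. z \<notin> U \<Longrightarrow> winding_number \<gamma> z = 0"
    by (auto simp: calculus_contour_def spec)
  have I0: "((\<lambda>z. f z / (z - \<mu>)) has_contour_integral k * f \<mu>) \<gamma>"
    using Cauchy_integral_over_power[OF U f \<mu> \<gamma>, of 0] by (simp add: k_def)
  have I1: "((\<lambda>z. f z / (z - \<mu>)\<^sup>2) has_contour_integral k * deriv f \<mu>) \<gamma>"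
    using Cauchy_integral_over_power[OF U f \<mu> \<gamma>, of 1] by (simp add: k_def power2_eq_square)
  let ?F = "\<lambda>t. scalar_op (vector_derivative \<gamma> (at t within {0..1})) o\<^sub>L
      (scalar_op (f (\<gamma> t)) o\<^sub>L resolvent ?B (\<gamma> t))"
  have "(?F has_integral (scalar_op (k * f \<mu>) o\<^sub>L id_blinfun) + (scalar_op (k * deriv f \<mu>) o\<^sub>L N)) {0..1}"
  proof (rule has_integral_eq[OF _ has_integral_add[OF op_integrand_has_integral[OF I0]
          op_integrand_has_integral[OF I1]]])
    fix t :: real
    assume "t \<in> {0..1}"
    then have "\<gamma> t \<in> path_image \<gamma>"
      by (simp add: path_image_def)
    then have ne: "\<gamma> t \<noteq> \<mu>"
      using \<gamma>(3) by blast
    show "(scalar_op (f (\<gamma> t) / (\<gamma> t - \<mu>) * vector_derivative \<gamma> (at t within {0..1})) o\<^sub>L id_blinfun) +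
        (scalar_op (f (\<gamma> t) / (\<gamma> t - \<mu>)\<^sup>2 * vector_derivative \<gamma> (at t within {0..1})) o\<^sub>L N) = ?F t"
      by (rule blinfun_eqI)
        (simp add: resolvent_square_zero(2)[OF N ne] blinfun.add_left scaleC_scaleC scaleC_add_right
          mult.commute)
  qed
  then have "op_contour_integral \<gamma> (\<lambda>z. scalar_op (f z) o\<^sub>L resolvent ?B z) =
      scalar_op (k * f \<mu>) + (scalar_op (k * deriv f \<mu>) o\<^sub>L N)"
    unfolding op_contour_integral_def scalar_op_compose_id by (rule integral_unique)
  then have "hol_calculus U f ?B =
      scalar_op (1 / k) o\<^sub>L (scalar_op (k * f \<mu>) + (scalar_op (k * deriv f \<mu>) o\<^sub>L N))"
    by (simp only: hol_calculus_def \<gamma>_def k_def)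
  also have "\<dots> = scalar_op (f \<mu>) + (scalar_op (deriv f \<mu>) o\<^sub>L N)"
    by (rule blinfun_eqI)
      (simp add: blinfun.add_left scaleC_add_right scaleC_scaleC k_def)
  finally show ?thesis .
qed

section \<open>The upper bound\<close>

lemma sector_op_half_planes:
  assumes \<alpha>: "0 < \<alpha>" "\<alpha> \<le> pi / 2" and B: "sector_op \<alpha> B \<mu> N" and x: "N x \<noteq> 0"
  shows "norm (N x) \<le> 2 * Re (cis (pi / 2 - \<alpha>) * \<mu>) * norm x"
    and "norm (N x) \<le> 2 * Re (cnj (cis (pi / 2 - \<alpha>)) * \<mu>) * norm x"
proof -
  have N: "clinear_op N" "N o\<^sub>L N = 0" and range: "numerical_range (scalar_op \<mu> + N) \<subseteq> sector \<alpha>"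
    using B clinear_op_minus_scalar[of B \<mu> N] by (auto simp: sector_op_def)
  show "norm (N x) \<le> 2 * Re (cis (pi / 2 - \<alpha>) * \<mu>) * norm x"
    using range mem_sector_iff[OF \<alpha>] by (intro square_zero_half_plane N x) auto
  show "norm (N x) \<le> 2 * Re (cnj (cis (pi / 2 - \<alpha>)) * \<mu>) * norm x"
    using range mem_sector_iff[OF \<alpha>] by (intro square_zero_half_plane N x) auto
qed

lemma sector_op_interior:
  assumes \<alpha>: "0 < \<alpha>" "\<alpha> \<le> pi / 2" and B: "sector_op \<alpha> B \<mu> N" and N: "N \<noteq> 0"
  shows "\<mu> \<in> interior (sector \<alpha>)"
proof -
  obtain x where x: "N x \<noteq> 0"
    using N blinfun_eqI[of N 0] by auto
  then have "0 < norm (N x)"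
    by simp
  note pos = sector_op_half_planes[OF \<alpha> B x, THEN order.strict_trans2[OF this]]
  then show ?thesis
    unfolding mem_interior_sector_iff[OF \<alpha>] using norm_ge_zero[of x]
    by (auto simp only: zero_less_mult_iff)
qed

lemma norm_hol_calculus_sector_le:
  fixes B :: "'a::complex_hilbert_space \<Rightarrow>\<^sub>L 'a"
  assumes \<alpha>: "0 < \<alpha>" "\<alpha> \<le> pi / 2" and nontriv: "(v :: 'a) \<noteq> 0"
    and B: "sector_op \<alpha> B \<mu> N" and f: "sector_fun \<alpha> f" and \<mu>: "\<mu> \<in> interior (sector \<alpha>)"
  shows "norm (hol_calculus (interior (sector \<alpha>)) f B) \<le> pi * sin \<alpha> / (2 * \<alpha>)"
proof -
  have N: "clinear_op N" "N o\<^sub>L N = 0" and B_eq: "B = scalar_op \<mu> + N"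
    using B clinear_op_minus_scalar[of B \<mu> N] by (auto simp: sector_op_def)
  have hol: "f holomorphic_on interior (sector \<alpha>)"
    using f by (simp add: sector_fun_def)
  have le: "cmod (f z) \<le> 1" if "z \<in> interior (sector \<alpha>)" for z
    using that interior_subset sector_fun_bound[OF f] by blast
  have pos: "0 < Re (cis (pi / 2 - \<alpha>) * \<mu>)" "0 < Re (cnj (cis (pi / 2 - \<alpha>)) * \<mu>)"
    using \<mu> mem_interior_sector_iff[OF \<alpha>] by blast+
  have "norm (N x) \<le> 2 * Re (cis (pi / 2 - \<alpha>) * \<mu>) * norm x" for x
    using sector_op_half_planes(1)[OF \<alpha> B, of x] pos
    by (cases "N x = 0") (auto simp del: times_complex.sel)
  then have d1: "norm N \<le> 2 * Re (cis (pi / 2 - \<alpha>) * \<mu>)"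
    using pos by (intro norm_blinfun_bound) (auto simp del: times_complex.sel)
  have "norm (N x) \<le> 2 * Re (cnj (cis (pi / 2 - \<alpha>)) * \<mu>) * norm x" for x
    using sector_op_half_planes(2)[OF \<alpha> B, of x] pos
    by (cases "N x = 0") (auto simp del: times_complex.sel)
  then have d2: "norm N \<le> 2 * Re (cnj (cis (pi / 2 - \<alpha>)) * \<mu>)"
    using pos by (intro norm_blinfun_bound) (auto simp del: times_complex.sel)
  have "connected (interior (sector \<alpha>))"
    using convex_sector[OF \<alpha>] by (intro convex_connected convex_interior)
  then have "hol_calculus (interior (sector \<alpha>)) f B =
      scalar_op (f \<mu>) + (scalar_op (deriv f \<mu>) o\<^sub>L N)"
    unfolding B_eq by (intro hol_calculus_square_zero[OF nontriv N] hol \<mu>) auto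
  also have "norm \<dots> \<le> pi * sin \<alpha> / (2 * \<alpha>)"
    using deriv_bound_sector[OF \<alpha> hol le \<mu> d1 d2] le[OF \<mu>] one_le_sector_constant[OF \<alpha>]
    by (intro norm_scalar_plus_square_zero_le N)
  finally show ?thesis .
qed

lemma norm_scalar_sector_le:
  fixes B :: "'a::complex_hilbert_space \<Rightarrow>\<^sub>L 'a"
  assumes \<alpha>: "0 < \<alpha>" "\<alpha> \<le> pi / 2" and nontriv: "(v :: 'a) \<noteq> 0"
    and B: "sector_op \<alpha> B \<mu> 0" and f: "sector_fun \<alpha> f"
  shows "norm (scalar_op (f \<mu>) :: 'a \<Rightarrow>\<^sub>L 'a) \<le> pi * sin \<alpha> / (2 * \<alpha>)"
proof -
  define u where "u = (1 / norm v) *\<^sub>R v"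
  have u: "norm u = 1"
    using nontriv by (simp add: u_def)
  then have "cinner (B u) u = \<mu>"
    using B by (simp add: sector_op_def cinner_scaleC_left cinner_self)
  then have "\<mu> \<in> sector \<alpha>"
    using B u by (force simp: sector_op_def numerical_range_def)
  then have "cmod (f \<mu>) \<le> 1"
    by (rule sector_fun_bound[OF f])
  then show ?thesis
    using norm_scalar_op_le[of "f \<mu>", where 'a = 'a] one_le_sector_constant[OF \<alpha>] by linarith
qed

section \<open>The extremal pair\<close>

lemma matrix_op_apply [simp]: "blinfun_apply (matrix_op A) x = A *v x"
  by transfer simp

definition N_ext :: "real \<Rightarrow> (complex ^ 2) \<Rightarrow>\<^sub>L (complex ^ 2)" where
  "N_ext \<alpha> = matrix_op ((2 * sin \<alpha>) *\<^sub>R vector [vector [0, 1], vector [0, 0]])"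

lemma N_ext_apply:
  "N_ext \<alpha> x $ 1 = of_real (2 * sin \<alpha>) * x $ 2"
  "N_ext \<alpha> x $ 2 = 0"
  by (simp_all add: N_ext_def matrix_vector_mult_def sum_2) (simp add: scaleR_conv_of_real)

lemma B_ext_eq: "B_ext \<alpha> = scalar_op 1 + N_ext \<alpha>"
  by (rule blinfun_eqI)
    (simp add: B_ext_def N_ext_def blinfun.add_left matrix_vector_mult_add_rdistrib)

lemma clinear_N_ext: "clinear_op (N_ext \<alpha>)"
  by (simp add: clinear_op_def vec_eq_iff forall_2 N_ext_apply scaleC_vec_def scaleC_complex_def)

lemma N_ext_square: "N_ext \<alpha> o\<^sub>L N_ext \<alpha> = 0"
  by (rule blinfun_eqI) (simp add: vec_eq_iff forall_2 N_ext_apply)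

lemma norm_vec2: "(norm (x :: complex ^ 2))\<^sup>2 = (cmod (x $ 1))\<^sup>2 + (cmod (x $ 2))\<^sup>2"
  by (simp add: norm_vec_def L2_set_def sum_2)

lemma norm_N_ext:
  assumes "0 \<le> sin \<alpha>"
  shows "norm (N_ext \<alpha>) = 2 * sin \<alpha>"
proof (rule antisym)
  have eq: "norm (N_ext \<alpha> x) = 2 * sin \<alpha> * cmod (x $ 2)" for x
  proof -
    have "(norm (N_ext \<alpha> x))\<^sup>2 = (2 * sin \<alpha> * cmod (x $ 2))\<^sup>2"
      by (simp add: norm_vec2 N_ext_apply norm_mult power_mult_distrib)
    then show ?thesis
      using assms by (simp add: power2_eq_iff_nonneg)
  qed
  show "norm (N_ext \<alpha>) \<le> 2 * sin \<alpha>"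
    unfolding eq[abs_def] using assms
    by (intro norm_blinfun_bound) (auto simp: eq intro!: mult_left_mono Finite_Cartesian_Product.norm_nth_le)
  have "norm (N_ext \<alpha> (axis 2 1)) \<le> norm (N_ext \<alpha>) * norm (axis 2 (1 :: complex) :: complex ^ 2)"
    by (rule norm_blinfun)
  moreover have "norm (axis 2 (1 :: complex) :: complex ^ 2) = 1"
    by (simp add: norm_vec_def L2_set_def sum_2 axis_def)
  ultimately show "2 * sin \<alpha> \<le> norm (N_ext \<alpha>)"
    by (simp add: eq)
qed

text \<open>The numerical range is the disc of centre \<open>1\<close> and radius \<open>sin \<alpha>\<close>, which touches both edges.\<close>

lemma sector_op_ext:
  assumes \<alpha>: "0 < \<alpha>" "\<alpha> \<le> pi / 2"
  shows "sector_op \<alpha> (B_ext \<alpha>) 1 (N_ext \<alpha>)"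
  unfolding sector_op_def
proof (intro conjI B_ext_eq N_ext_square)
  show "clinear_op (B_ext \<alpha>)"
    using clinear_N_ext
    by (simp add: B_ext_eq clinear_op_def blinfun.add_left scaleC_add_right)
  show "numerical_range (B_ext \<alpha>) \<subseteq> sector \<alpha>"
  proof
    fix z
    assume "z \<in> numerical_range (B_ext \<alpha>)"
    then obtain x where x: "norm x = 1" and z: "z = cinner (B_ext \<alpha> x) x"
      by (auto simp: numerical_range_def)
    have sin_pos: "0 < sin \<alpha>"
      using \<alpha> by (intro sin_gt_zero) auto
    define w where "w = cinner (N_ext \<alpha> x) x"
    have z: "z = 1 + w"
      by (simp add: z w_def B_ext_eq blinfun.add_left cinner_add_left cinner_self x)
    have "w = of_real (2 * sin \<alpha>) * x $ 2 * cnj (x $ 1)"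
      by (simp add: w_def cinner_vec_def sum_2 N_ext_apply cinner_complex_def)
    then have "cmod w = sin \<alpha> * (2 * cmod (x $ 1) * cmod (x $ 2))"
      using sin_pos by (simp add: norm_mult)
    also have "\<dots> \<le> sin \<alpha> * ((cmod (x $ 1))\<^sup>2 + (cmod (x $ 2))\<^sup>2)"
      using sin_pos by (intro mult_left_mono sum_squares_bound) auto
    also have "\<dots> = sin \<alpha>"
      using norm_vec2[of x] x by simp
    finally have w: "cmod w \<le> sin \<alpha>" .
    have "0 \<le> Re (c * z)" if "c \<in> {cis (pi / 2 - \<alpha>), cnj (cis (pi / 2 - \<alpha>))}" for c
    proof -
      have "cmod c = 1" "Re c = sin \<alpha>"
        using that by (auto simp: cos_diff)
      moreover have "\<bar>Re (c * w)\<bar> \<le> cmod (c * w)"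
        by (rule abs_Re_le_cmod)
      ultimately show ?thesis
        using w by (simp add: z distrib_left norm_mult del: times_complex.sel)
    qed
    then show "z \<in> sector \<alpha>"
      unfolding mem_sector_iff[OF \<alpha>] by blast
  qed
qed

text \<open>
  A neighbourhood of the point at infinity has compact complement: for closed \<open>S\<close> the part of \<open>S\<close> that
  \<open>f\<close> keeps away from \<open>L\<close> is closed, and the limit makes it bounded.
\<close>

lemma continuous_map_Alexandroff_case_option:
  fixes f :: "'a::euclidean_space \<Rightarrow> 'b::topological_space"
  assumes S: "closed S" and f: "continuous_on S f" and L: "(f \<longlongrightarrow> L) (inf at_infinity (principal S))"
  shows "continuous_map (Alexandroff_compactification (top_of_set S)) euclidean (case_option L f)"
  unfolding continuous_map
proof (intro conjI allI impI)
  let ?X = "Alexandroff_compactification (top_of_set S)"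
  fix V :: "'b set"
  assume "openin euclidean V"
  then have V: "open V"
    by simp
  show "openin ?X {x \<in> topspace ?X. case_option L f x \<in> V}"
  proof (cases "L \<in> V")
    case False
    have "{x \<in> topspace ?X. case_option L f x \<in> V} = Some ` (S \<inter> f -` V)"
      using False by auto
    moreover have "openin (top_of_set S) (S \<inter> f -` V)"
      using f V by (rule continuous_openin_preimage_gen)
    ultimately show ?thesis
      by simp
  next
    case True
    define C where "C = S \<inter> f -` (- V)"
    have eq: "{x \<in> topspace ?X. case_option L f x \<in> V} = insert None (Some ` (topspace (top_of_set S) - C))"
      using True by (auto simp: C_def)
    have closedin: "closedin (top_of_set S) C"
      unfolding C_def using f V by (intro continuous_closedin_preimage) auto
    then have closed: "closed C"
      using S by (rule closedin_closed_trans)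
    have "\<forall>\<^sub>F x in at_infinity. x \<in> S \<longrightarrow> f x \<in> V"
      using topological_tendstoD[OF L V True] by (simp add: eventually_inf_principal)
    then obtain b where b: "\<And>x. b \<le> norm x \<Longrightarrow> x \<in> S \<Longrightarrow> f x \<in> V"
      by (auto simp: eventually_at_infinity)
    have "norm x \<le> b" if "x \<in> C" for x
      using that b[of x] by (force simp: C_def)
    then have "bounded C"
      by (auto simp: bounded_iff)
    with closed have "compact C"
      by (simp add: compact_eq_bounded_closed)
    moreover have "C \<subseteq> S"
      by (auto simp: C_def)
    ultimately have "compactin (top_of_set S) C"
      by (simp add: compactin_subtopology)
    then show ?thesis
      unfolding eq openin_Alexandroff_compactification using closedin by blast
  qed
qed auto

lemma powr_rcis:
  assumes "0 < r" "\<bar>\<theta>\<bar> < pi"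
  shows "rcis r \<theta> powr of_real p = rcis (r powr p) (p * \<theta>)"
proof -
  have "rcis r \<theta> = exp (of_real (ln r) + \<i> * of_real \<theta>)"
    using assms(1) by (simp add: rcis_def exp_add cis_conv_exp exp_of_real)
  moreover have "Ln \<dots> = of_real (ln r) + \<i> * of_real \<theta>"
    using assms(2) by (intro Ln_exp) auto
  moreover have "rcis r \<theta> \<noteq> 0"
    using assms(1) by simp
  ultimately have "rcis r \<theta> powr of_real p = exp (of_real (p * ln r) + \<i> * of_real (p * \<theta>))"
    by (simp add: powr_def algebra_simps)
  also have "\<dots> = of_real (exp (p * ln r)) * cis (p * \<theta>)"
    unfolding exp_add cis_conv_exp exp_of_real ..
  finally show ?thesis
    using assms(1) by (simp add: rcis_def powr_def)
qed

lemma Re_powr_sector_nonneg: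
  assumes \<alpha>: "0 < \<alpha>" "\<alpha> \<le> pi / 2" and z: "z \<in> sector \<alpha>"
  shows "0 \<le> Re (z powr of_real (pi / (2 * \<alpha>)))"
proof -
  define p where "p = pi / (2 * \<alpha>)"
  obtain r \<theta> where *: "z = rcis r \<theta>" "0 \<le> r" "\<bar>\<theta>\<bar> \<le> \<alpha>"
    using z by (auto simp: sector_def)
  have "0 \<le> Re (z powr of_real p)"
  proof (cases "r = 0")
    case False
    have "\<bar>p * \<theta>\<bar> \<le> p * \<alpha>"
      using * \<alpha> unfolding abs_mult p_def by (intro mult_mono) auto
    also have "\<dots> = pi / 2"
      using \<alpha> by (simp add: p_def)
    finally have "0 \<le> cos (p * \<theta>)"
      unfolding abs_le_iff by (intro cos_ge_zero) linarith+
    moreover have "\<bar>\<theta>\<bar> < pi"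
      using * \<alpha> pi_gt_zero by linarith
    ultimately show ?thesis
      using * False by (simp add: powr_rcis)
  qed (simp add: *)
  then show ?thesis
    by (simp only: p_def)
qed

lemma norm_sub_one_le_norm_add_one:
  assumes "0 \<le> Re w"
  shows "w + 1 \<noteq> 0" and "cmod (w - 1) \<le> cmod (w + 1)" and "cmod w \<le> cmod (w + 1)"
proof -
  show "w + 1 \<noteq> 0"
  proof
    assume "w + 1 = 0"
    then have "Re (w + 1) = 0"
      by simp
    with assms show False
      by simp
  qed
  show "cmod (w - 1) \<le> cmod (w + 1)" "cmod w \<le> cmod (w + 1)"
    using assms by (auto simp: cmod_def power2_eq_square algebra_simps intro!: real_sqrt_le_mono)
qed

lemma sector_fun_ext:
  assumes \<alpha>: "0 < \<alpha>" "\<alpha> \<le> pi / 2"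
  shows "sector_fun \<alpha> (f_ext \<alpha>)"
proof -
  define p where "p = pi / (2 * \<alpha>)"
  have p: "1 \<le> p"
    using \<alpha> by (simp add: p_def field_simps)
  define g where "g = (\<lambda>z :: complex. z powr of_real p)"
  have f: "f_ext \<alpha> = (\<lambda>z. (g z - 1) / (g z + 1))"
    by (simp add: f_ext_def g_def p_def fun_eq_iff)
  have g: "0 \<le> Re (g z)" if "z \<in> sector \<alpha>" for z
    using Re_powr_sector_nonneg[OF \<alpha> that] by (simp add: g_def p_def)
  note bounds = norm_sub_one_le_norm_add_one[OF g]
  have Re_nonneg: "0 \<le> Re z" "z \<in> interior (sector \<alpha>) \<Longrightarrow> 0 < Re z" if z: "z \<in> sector \<alpha>" for z
  proof -
    obtain r \<theta> where "z = rcis r \<theta>" "0 \<le> r" "\<bar>\<theta>\<bar> \<le> \<alpha>"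
      using z by (auto simp: sector_def)
    then show "0 \<le> Re z"
      using \<alpha> by (auto intro!: mult_nonneg_nonneg cos_ge_zero)
  next
    assume "z \<in> interior (sector \<alpha>)"
    then obtain r \<theta> where "z = rcis r \<theta>" "0 < r" "\<bar>\<theta>\<bar> < \<alpha>"
      unfolding mem_interior_sector_polar[OF \<alpha>] by auto
    then show "0 < Re z"
      using \<alpha> by (auto intro!: mult_pos_pos cos_gt_zero_pi)
  qed
  have int: "z \<in> sector \<alpha>" if "z \<in> interior (sector \<alpha>)" for z
    using that interior_subset by blast
  have "g holomorphic_on interior (sector \<alpha>)"
    unfolding g_def using Re_nonneg(2) int
    by (intro holomorphic_intros) (force simp: complex_nonpos_Reals_iff)
  then have "f_ext \<alpha> holomorphic_on interior (sector \<alpha>)"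
    unfolding f using bounds(1) int by (intro holomorphic_intros) auto
  moreover have "continuous_on (sector \<alpha>) g"
    unfolding g_def using Re_nonneg(1) p by (intro continuous_intros) auto
  then have "continuous_on (sector \<alpha>) (f_ext \<alpha>)"
    unfolding f using bounds(1) by (intro continuous_intros) auto
  moreover have "(f_ext \<alpha> \<longlongrightarrow> 1) (inf at_infinity (principal (sector \<alpha>)))"
  proof (rule Lim_transform[OF tendsto_const])
    \<comment> \<open>\<open>f - 1 = - 2 / (z\<^sup>p + 1)\<close>, and \<open>\<bar>z\<bar> \<le> \<bar>z\<^sup>p\<bar> \<le> \<bar>z\<^sup>p + 1\<bar>\<close> because \<open>p \<ge> 1\<close> and \<open>Re z\<^sup>p \<ge> 0\<close>.\<close>
    have le: "cmod (f_ext \<alpha> z - 1) \<le> 2 * inverse (norm z)" if z: "z \<in> sector \<alpha>" "1 \<le> norm z" for z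
    proof -
      have "f_ext \<alpha> z - 1 = - 2 / (g z + 1)"
        using bounds(1)[OF z(1)] by (simp add: f field_simps)
      then have "cmod (f_ext \<alpha> z - 1) = 2 / cmod (g z + 1)"
        by (simp add: norm_divide)
      moreover have "norm z \<le> cmod (g z + 1)"
      proof -
        have "norm z powr 1 \<le> norm z powr p"
          using z p by (intro powr_mono) auto
        also have "\<dots> = cmod (g z)"
          by (simp add: g_def norm_powr_real_powr')
        finally show ?thesis
          using bounds(3)[OF z(1)] z by simp
      qed
      moreover from this have "2 / cmod (g z + 1) \<le> 2 / norm z"
        using z(2) by (intro frac_le) auto
      ultimately show ?thesis
        by (simp add: divide_inverse)
    qed
    have "\<forall>\<^sub>F z in inf at_infinity (principal (sector \<alpha>)). norm (f_ext \<alpha> z - 1) \<le> 2 * inverse (norm z)"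
      unfolding eventually_inf_principal eventually_at_infinity using le by auto
    moreover have "((\<lambda>z :: complex. 2 * inverse (norm z)) \<longlongrightarrow> 2 * 0) at_infinity"
      by (intro tendsto_mult tendsto_const tendsto_inverse_0_at_top filterlim_norm_at_top)
    then have "((\<lambda>z :: complex. 2 * inverse (norm z)) \<longlongrightarrow> 0) (inf at_infinity (principal (sector \<alpha>)))"
      by (intro tendsto_mono[OF inf_le1]) simp
    ultimately show "((\<lambda>z. f_ext \<alpha> z - 1) \<longlongrightarrow> 0) (inf at_infinity (principal (sector \<alpha>)))"
      by (rule Lim_null_comparison)
  qed
  ultimately have "f_ext \<alpha> holomorphic_on interior (sector \<alpha>)"
    and "continuous_map (Alexandroff_compactification (top_of_set (sector \<alpha>))) euclidean
      (case_option 1 (f_ext \<alpha>))"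
    using continuous_map_Alexandroff_case_option[OF closed_sector[OF \<alpha>]] by blast+
  moreover have "(SUP z\<in>sector \<alpha>. cmod (f_ext \<alpha> z)) \<le> 1"
  proof (rule cSUP_least)
    have "0 \<in> sector \<alpha>"
      by (simp add: mem_sector_iff[OF \<alpha>])
    then show "sector \<alpha> \<noteq> {}"
      by blast
    show "cmod (f_ext \<alpha> z) \<le> 1" if "z \<in> sector \<alpha>" for z
      using bounds(2)[OF that] by (simp add: f norm_divide divide_le_eq_1)
  qed
  ultimately show ?thesis
    unfolding sector_fun_def by blast
qed

lemma one_mem_interior_sector:
  assumes \<alpha>: "0 < \<alpha>" "\<alpha> \<le> pi / 2"
  shows "1 \<in> interior (sector \<alpha>)"
  using \<alpha> by (simp add: mem_interior_sector_iff[OF \<alpha>] cos_diff sin_gt_zero)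

lemma f_ext_one:
  "f_ext \<alpha> 1 = 0" "deriv (f_ext \<alpha>) 1 = of_real (pi / (2 * \<alpha>)) / 2"
proof -
  show "f_ext \<alpha> 1 = 0"
    by (simp add: f_ext_def)
  define p where "p = complex_of_real (pi / (2 * \<alpha>))"
  have "((\<lambda>z. (z powr p - 1) / (z powr p + 1)) has_field_derivative p / 2) (at 1)"
    by (auto intro!: derivative_eq_intros)
  then show "deriv (f_ext \<alpha>) 1 = of_real (pi / (2 * \<alpha>)) / 2"
    unfolding f_ext_def[abs_def] p_def by (rule DERIV_imp_deriv)
qed

lemma norm_hol_calculus_ext:
  assumes \<alpha>: "0 < \<alpha>" "\<alpha> \<le> pi / 2"
  shows "norm (hol_calculus (interior (sector \<alpha>)) (f_ext \<alpha>) (B_ext \<alpha>)) = pi * sin \<alpha> / (2 * \<alpha>)"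
proof -
  have "axis 1 1 \<noteq> (0 :: complex ^ 2)"
    by (simp add: axis_eq_0_iff)
  moreover have "connected (interior (sector \<alpha>))"
    using convex_sector[OF \<alpha>] by (intro convex_connected convex_interior)
  moreover have "f_ext \<alpha> holomorphic_on interior (sector \<alpha>)"
    using sector_fun_ext[OF \<alpha>] by (simp add: sector_fun_def)
  ultimately have "hol_calculus (interior (sector \<alpha>)) (f_ext \<alpha>) (B_ext \<alpha>) =
      scalar_op (f_ext \<alpha> 1) + (scalar_op (deriv (f_ext \<alpha>) 1) o\<^sub>L N_ext \<alpha>)"
    unfolding B_ext_eq using one_mem_interior_sector[OF \<alpha>]
    by (intro hol_calculus_square_zero clinear_N_ext N_ext_square) auto
  also have "\<dots> = (pi / (2 * \<alpha>) / 2) *\<^sub>R N_ext \<alpha>"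
    by (rule blinfun_eqI)
      (simp add: f_ext_one blinfun.add_left blinfun.scaleR_left scaleR_scaleC)
  also have "norm \<dots> = pi * sin \<alpha> / (2 * \<alpha>)"
    using \<alpha> sin_gt_zero[of \<alpha>] by (simp add: norm_N_ext)
  finally show ?thesis .
qed

theorem theorem1p1:
  fixes \<alpha> :: real
  assumes "0 < \<alpha>" and "\<alpha> \<le> pi / 2"
  shows "(\<forall>(B :: 'a::complex_hilbert_space \<Rightarrow>\<^sub>L 'a) \<mu> N f.
            sector_op \<alpha> B \<mu> N \<longrightarrow> sector_fun \<alpha> f \<longrightarrow>
              (\<mu> \<in> interior (sector \<alpha>) \<or> N = 0) \<and>
              (\<mu> \<in> interior (sector \<alpha>) \<longrightarrow>
                 norm (hol_calculus (interior (sector \<alpha>)) f B) \<le> pi * sin \<alpha> / (2 * \<alpha>)) \<and>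
              (N = 0 \<longrightarrow>
                 norm (scalar_op (f \<mu>) :: 'a \<Rightarrow>\<^sub>L 'a) \<le> pi * sin \<alpha> / (2 * \<alpha>)))
       \<and> ((\<exists>N. sector_op \<alpha> (B_ext \<alpha>) 1 N) \<and> sector_fun \<alpha> (f_ext \<alpha>) \<and>
          1 \<in> interior (sector \<alpha>) \<and>
          norm (hol_calculus (interior (sector \<alpha>)) (f_ext \<alpha>) (B_ext \<alpha>)) = pi * sin \<alpha> / (2 * \<alpha>))"
proof (intro conjI allI impI)
  note \<alpha> = assms
  fix B N :: "'a \<Rightarrow>\<^sub>L 'a" and \<mu> f
  assume B: "sector_op \<alpha> B \<mu> N" and f: "sector_fun \<alpha> f"
  \<comment> \<open>On the zero space the spectrum is empty and \<open>\<mu>\<close> arbitrary, but every operator vanishes.\<close>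
  have zero: "norm T \<le> pi * sin \<alpha> / (2 * \<alpha>)" if "\<forall>v :: 'a. v = 0" for T :: "'a \<Rightarrow>\<^sub>L 'a"
  proof -
    have "T = 0"
      using that by (intro blinfun_eqI) auto
    then show ?thesis
      using one_le_sector_constant[OF \<alpha>] by simp
  qed
  show "\<mu> \<in> interior (sector \<alpha>) \<or> N = 0"
    using sector_op_interior[OF \<alpha> B] by blast
  show "norm (hol_calculus (interior (sector \<alpha>)) f B) \<le> pi * sin \<alpha> / (2 * \<alpha>)"
    if "\<mu> \<in> interior (sector \<alpha>)"
    using zero norm_hol_calculus_sector_le[OF \<alpha> _ B f that] by blast
  show "norm (scalar_op (f \<mu>) :: 'a \<Rightarrow>\<^sub>L 'a) \<le> pi * sin \<alpha> / (2 * \<alpha>)" if "N = 0"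
    using zero norm_scalar_sector_le[OF \<alpha> _ _ f, of _ B \<mu>] B that by blast
next
  show "\<exists>N. sector_op \<alpha> (B_ext \<alpha>) 1 N"
    using sector_op_ext[OF assms] by blast
qed (simp_all only: sector_fun_ext[OF assms] one_mem_interior_sector[OF assms]
    norm_hol_calculus_ext[OF assms])

end
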